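(* Let $\Gamma$ be a finitely generated, infinite group and let $\mathcal G$ be the Cayley graph of $\Gamma$ with respect to a finite symmetric generating set. The following conditions are equivalent: (i) there exists a $\Gamma$-invariant random connected spanning subgraph $\omega$ of $\mathcal G$ (i.e. connected and containing all vertices) with $p_{\mathrm{conn}}(\omega)=1$ almost surely; (ii) there exists a $\Gamma$-invariant random nonempty connected subgraph $\omega$ of $\mathcal G$ with $p_{\mathrm{conn}}(\omega)=1$ with positive probability. Moreover, if $\Gamma$ satisfies (i), or equivalently (ii), then $\Gamma$ has the Haagerup property.
   Context: Right Cayley graph: vertex set $\Gamma$, edges $[g,gs]$, $g\in\Gamma$, $s\in S$, with $S$ a finite symmetric generating set; $\Gamma$ acts by left multiplication. A $\Gamma$-invariant random subgraph of $\mathcal G$ is a random subgraph (a random set of vertices together with a random set of edges between them) whose law is invariant under $\Gamma$. For a countable, locally finite, connected graph $\mathcal H=(V,E)$ with graph distance $d$, let $\tau_p(u,v)$ denote the probability that $u,v\in V$ are in the same connected component in $p$-Bernoulli bond percolation on $\mathcal H$ (each edge is kept independently with probability $p$). Define $$p_{\mathrm{conn}}(\mathcal H)=\sup\Bigl\{p\in[0,1]:\lim_{r\to\infty}\sup_{u,v\in V,\ d(u,v)>r}\tau_p(u,v)=0\Bigr\}.$$ $\Gamma$ has the Haagerup property if it admits an affine isometric action on a Hilbert space $H$ which is metrically proper, i.e. for every bounded $B\subset H$ the set $\{g\in\Gamma:gB\cap B\ne\emptyset\}$ is finite. *)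

theory Defs
  imports
    "HOL-Probability.Probability"
    "HOL-Algebra.Algebraic_Closure_Type"
    "HOL-Algebra.Generated_Groups"
    "HOL-Algebra.Group_Action"
begin

section \<open>Graphs, Bernoulli bond percolation and the connectivity threshold\<close>

text \<open>
  A graph is a pair of a vertex set and an edge set, an undirected edge being the set of its
  end points. A loop at \<open>v\<close> is the singleton \<open>{v}\<close>; loops occur in a Cayley
  graph exactly when the generating set contains the identity.
\<close>

type_synonym 'v graph = "'v set \<times> 'v set set"

definition is_subgraph :: "'v graph \<Rightarrow> 'v graph \<Rightarrow> bool" where
  "is_subgraph H K \<longleftrightarrow>
     fst H \<subseteq> fst K \<and> snd H \<subseteq> snd K \<and> (\<forall>e\<in>snd H. e \<subseteq> fst H)"

definition adj :: "'v set set \<Rightarrow> ('v \<times> 'v) set" where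
  "adj E = {(u, v). {u, v} \<in> E}"

definition graph_connected :: "'v graph \<Rightarrow> bool" where
  "graph_connected H \<longleftrightarrow> (\<forall>u\<in>fst H. \<forall>v\<in>fst H. (u, v) \<in> (adj (snd H))\<^sup>*)"

text \<open>The distance is \<open>\<infinity>\<close> between vertices in different components.\<close>

definition graph_dist :: "'v graph \<Rightarrow> 'v \<Rightarrow> 'v \<Rightarrow> enat" where
  "graph_dist H u v = (INF n\<in>{n. (u, v) \<in> adj (snd H) ^^ n}. enat n)"

text \<open>A percolation configuration \<open>x\<close> keeps the edges \<open>e\<close> with \<open>x e = True\<close>.\<close>

definition bond_percolation :: "real \<Rightarrow> 'v graph \<Rightarrow> ('v set \<Rightarrow> bool) measure" where
  "bond_percolation p H = Pi\<^sub>M (snd H) (\<lambda>_. measure_pmf (bernoulli_pmf p))"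

definition two_point :: "'v graph \<Rightarrow> real \<Rightarrow> 'v \<Rightarrow> 'v \<Rightarrow> real" where
  "two_point H p u v =
     measure (bond_percolation p H)
       {x \<in> space (bond_percolation p H). (u, v) \<in> (adj {e \<in> snd H. x e})\<^sup>*}"

text \<open>
  The inner supremum is taken in \<^typ>\<open>ennreal\<close>, so that it is \<open>0\<close> when no two vertices are at
  distance greater than \<open>r\<close>. The outer set always contains \<open>0\<close> and is bounded by \<open>1\<close>.
\<close>

definition p_conn :: "'v graph \<Rightarrow> real" where
  "p_conn H = Sup {p \<in> {0..1}.
     (\<lambda>r::nat. SUP (u, v)\<in>{(u, v). u \<in> fst H \<and> v \<in> fst H \<and> graph_dist H u v > enat r}.
        ennreal (two_point H p u v)) \<longlonglongrightarrow> 0}"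


section \<open>Cayley graphs and invariant random subgraphs\<close>

definition cayley_graph :: "('a, 'b) monoid_scheme \<Rightarrow> 'a set \<Rightarrow> 'a graph" where
  "cayley_graph G S = (carrier G, {{g, g \<otimes>\<^bsub>G\<^esub> s} |g s. g \<in> carrier G \<and> s \<in> S})"

definition translate :: "('a, 'b) monoid_scheme \<Rightarrow> 'a \<Rightarrow> 'a graph \<Rightarrow> 'a graph" where
  "translate G g H = ((\<lambda>x. g \<otimes>\<^bsub>G\<^esub> x) ` fst H, (\<lambda>e. (\<lambda>x. g \<otimes>\<^bsub>G\<^esub> x) ` e) ` snd H)"

text \<open>
  The subgraphs of \<open>K\<close> with the product \<open>\<sigma>\<close>-algebra, which is generated by the events that a
  given vertex, respectively a given edge, is present.
\<close>

definition subgraph_space :: "'v graph \<Rightarrow> 'v graph measure" where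
  "subgraph_space K = sigma {H. is_subgraph H K}
     ({{H. is_subgraph H K \<and> v \<in> fst H} |v. v \<in> fst K} \<union>
      {{H. is_subgraph H K \<and> e \<in> snd H} |e. e \<in> snd K})"

text \<open>A random subgraph is represented by its law \<open>\<mu>\<close>.\<close>

definition invariant_random_subgraph ::
  "('a, 'b) monoid_scheme \<Rightarrow> 'a set \<Rightarrow> 'a graph measure \<Rightarrow> bool" where
  "invariant_random_subgraph G S \<mu> \<longleftrightarrow>
     prob_space \<mu> \<and> sets \<mu> = sets (subgraph_space (cayley_graph G S)) \<and>
     (\<forall>g\<in>carrier G. distr \<mu> (subgraph_space (cayley_graph G S)) (translate G g) = \<mu>)"

definition random_spanning_pconn_1 :: "('a, 'b) monoid_scheme \<Rightarrow> 'a set \<Rightarrow> bool" where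
  "random_spanning_pconn_1 G S \<longleftrightarrow>
     (\<exists>\<mu>. invariant_random_subgraph G S \<mu> \<and>
        (AE \<omega> in \<mu>. graph_connected \<omega> \<and> fst \<omega> = carrier G) \<and>
        (AE \<omega> in \<mu>. p_conn \<omega> = 1))"

definition random_nonempty_pconn_1_pos :: "('a, 'b) monoid_scheme \<Rightarrow> 'a set \<Rightarrow> bool" where
  "random_nonempty_pconn_1_pos G S \<longleftrightarrow>
     (\<exists>\<mu>. invariant_random_subgraph G S \<mu> \<and>
        (AE \<omega> in \<mu>. graph_connected \<omega> \<and> fst \<omega> \<noteq> {}) \<and>
        measure \<mu> {\<omega> \<in> space \<mu>. p_conn \<omega> = 1} > 0)"


section \<open>The Haagerup property\<close>

text \<open>
  Hilbert spaces are given by explicit carriers, so that one can quantify over them inside a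
  formula. \<^const>\<open>ring_of_type_algebra\<close> is the field of real numbers here; the multiplicative part of
  the module record plays no role.
\<close>

locale inner_product_space = Module.module "ring_of_type_algebra :: real ring" H
  for H :: "(real, 'h) module" (structure) +
  fixes ip :: "'h \<Rightarrow> 'h \<Rightarrow> real"
  assumes ip_commute: "\<lbrakk>x \<in> carrier H; y \<in> carrier H\<rbrakk> \<Longrightarrow> ip x y = ip y x"
    and ip_add_left: "\<lbrakk>x \<in> carrier H; y \<in> carrier H; z \<in> carrier H\<rbrakk> \<Longrightarrow>
          ip (x \<oplus>\<^bsub>H\<^esub> y) z = ip x z + ip y z"
    and ip_smult_left: "\<lbrakk>x \<in> carrier H; y \<in> carrier H\<rbrakk> \<Longrightarrow> ip (a \<odot>\<^bsub>H\<^esub> x) y = a * ip x y"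
    and ip_nonneg: "x \<in> carrier H \<Longrightarrow> 0 \<le> ip x x"
    and ip_eq_zero: "\<lbrakk>x \<in> carrier H; ip x x = 0\<rbrakk> \<Longrightarrow> x = \<zero>\<^bsub>H\<^esub>"
begin

text \<open>
  The value \<open>0\<close> outside the carrier is there because \<^locale>\<open>Metric_space\<close> requires symmetry and
  nonnegativity for all elements of the type.
\<close>

definition hdist :: "'h \<Rightarrow> 'h \<Rightarrow> real" where
  "hdist x y = (if x \<in> carrier H \<and> y \<in> carrier H
     then sqrt (ip (x \<ominus>\<^bsub>H\<^esub> y) (x \<ominus>\<^bsub>H\<^esub> y)) else 0)"

lemma ip_add_right:
  assumes "x \<in> carrier H" "y \<in> carrier H" "z \<in> carrier H"
  shows "ip z (x \<oplus>\<^bsub>H\<^esub> y) = ip z x + ip z y"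
  using assms by (metis ip_commute ip_add_left M.add.m_closed)

lemma smult_closed_real: "x \<in> carrier H \<Longrightarrow> a \<odot>\<^bsub>H\<^esub> x \<in> carrier H"
  using smult_closed[of a x] by (simp add: ring_of_type_algebra_def)

lemma ip_smult_right:
  assumes "x \<in> carrier H" "y \<in> carrier H"
  shows "ip y (a \<odot>\<^bsub>H\<^esub> x) = a * ip y x"
  using assms by (metis ip_commute ip_smult_left smult_closed_real)

lemma ip_Cauchy_Schwarz:
  assumes x: "x \<in> carrier H" and y: "y \<in> carrier H"
  shows "(ip x y)\<^sup>2 \<le> ip x x * ip y y"
proof (cases "ip y y = 0")
  case True
  have z: "ip \<zero>\<^bsub>H\<^esub> x = 0"
    using ip_add_left[of "\<zero>\<^bsub>H\<^esub>" "\<zero>\<^bsub>H\<^esub>" x] x by simp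
  have "y = \<zero>\<^bsub>H\<^esub>" using True y ip_eq_zero by blast
  hence "ip x y = 0" using z x by (metis ip_commute M.zero_closed)
  thus ?thesis using True by simp
next
  case False
  define t where "t = - (ip x y / ip y y)"
  have c: "t \<odot>\<^bsub>H\<^esub> y \<in> carrier H" using y by (rule smult_closed_real)
  have "0 \<le> ip (x \<oplus>\<^bsub>H\<^esub> t \<odot>\<^bsub>H\<^esub> y) (x \<oplus>\<^bsub>H\<^esub> t \<odot>\<^bsub>H\<^esub> y)"
    using x c by (intro ip_nonneg) simp
  also have "\<dots> = ip x x + 2 * t * ip x y + t * t * ip y y"
    using x y c ip_commute[of y x]
    by (simp add: ip_add_left ip_add_right ip_smult_left ip_smult_right algebra_simps)
  also have "\<dots> = ip x x - (ip x y)\<^sup>2 / ip y y"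
    using False by (simp add: t_def field_simps power2_eq_square)
  finally have "(ip x y)\<^sup>2 / ip y y \<le> ip x x" by simp
  moreover have "ip y y > 0" using False ip_nonneg[OF y] by simp
  ultimately show ?thesis by (simp add: pos_divide_le_eq)
qed

lemma ip_norm_triangle:
  assumes x: "x \<in> carrier H" and y: "y \<in> carrier H"
  shows "sqrt (ip (x \<oplus>\<^bsub>H\<^esub> y) (x \<oplus>\<^bsub>H\<^esub> y)) \<le> sqrt (ip x x) + sqrt (ip y y)"
proof -
  have "ip x y \<le> sqrt (ip x x * ip y y)"
    using ip_Cauchy_Schwarz[OF x y] real_le_rsqrt by blast
  moreover have "ip (x \<oplus>\<^bsub>H\<^esub> y) (x \<oplus>\<^bsub>H\<^esub> y) = ip x x + 2 * ip x y + ip y y"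
    using x y ip_commute[of y x] by (simp add: ip_add_left ip_add_right)
  ultimately have "ip (x \<oplus>\<^bsub>H\<^esub> y) (x \<oplus>\<^bsub>H\<^esub> y) \<le> (sqrt (ip x x) + sqrt (ip y y))\<^sup>2"
    using ip_nonneg[OF x] ip_nonneg[OF y] by (simp add: power2_sum real_sqrt_mult)
  thus ?thesis
    by (intro real_le_lsqrt) (auto intro: add_nonneg_nonneg simp: ip_nonneg x y)
qed

lemma ip_minus_self:
  assumes x: "x \<in> carrier H"
  shows "ip (\<ominus>\<^bsub>H\<^esub> x) (\<ominus>\<^bsub>H\<^esub> x) = ip x x"
proof -
  have z: "ip \<zero>\<^bsub>H\<^esub> u = 0" if "u \<in> carrier H" for u
    using ip_add_left[of "\<zero>\<^bsub>H\<^esub>" "\<zero>\<^bsub>H\<^esub>" u] that by simp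
  have n: "ip (\<ominus>\<^bsub>H\<^esub> x) u = - ip x u" if "u \<in> carrier H" for u
    using ip_add_left[of x "\<ominus>\<^bsub>H\<^esub> x" u] that x z[OF that] by (simp add: M.r_neg)
  show ?thesis using n[of "\<ominus>\<^bsub>H\<^esub> x"] n[of x] ip_commute[of x "\<ominus>\<^bsub>H\<^esub> x"] x by simp
qed

sublocale Metric_space "carrier H" hdist
proof
  show "0 \<le> hdist x y" for x y
    by (simp add: hdist_def ip_nonneg)
  show "hdist x y = hdist y x" for x y
  proof (cases "x \<in> carrier H \<and> y \<in> carrier H")
    case True
    hence "x \<ominus>\<^bsub>H\<^esub> y = \<ominus>\<^bsub>H\<^esub> (y \<ominus>\<^bsub>H\<^esub> x)"
      by (simp add: M.minus_eq M.minus_add M.a_comm)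
    thus ?thesis using True by (simp add: hdist_def ip_minus_self)
  qed (auto simp: hdist_def)
  show "hdist x y = 0 \<longleftrightarrow> x = y" if x: "x \<in> carrier H" and y: "y \<in> carrier H" for x y
  proof
    assume "hdist x y = 0"
    hence "x \<ominus>\<^bsub>H\<^esub> y = \<zero>\<^bsub>H\<^esub>" using x y by (simp add: hdist_def ip_eq_zero)
    moreover have "x = (x \<ominus>\<^bsub>H\<^esub> y) \<oplus>\<^bsub>H\<^esub> y"
      using x y by (simp add: M.minus_eq M.a_assoc M.l_neg)
    ultimately show "x = y" using y by simp
  next
    assume "x = y"
    thus "hdist x y = 0"
      using x ip_add_left[of "\<zero>\<^bsub>H\<^esub>" "\<zero>\<^bsub>H\<^esub>" "\<zero>\<^bsub>H\<^esub>"]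
      by (simp add: hdist_def M.minus_eq M.r_neg)
  qed
  show "hdist x z \<le> hdist x y + hdist y z"
    if "x \<in> carrier H" "y \<in> carrier H" "z \<in> carrier H" for x y z
  proof -
    have "x \<ominus>\<^bsub>H\<^esub> z = (x \<ominus>\<^bsub>H\<^esub> y) \<oplus>\<^bsub>H\<^esub> (y \<ominus>\<^bsub>H\<^esub> z)"
      using that by (simp add: M.minus_eq M.a_assoc M.r_neg1)
    thus ?thesis using that ip_norm_triangle[of "x \<ominus>\<^bsub>H\<^esub> y" "y \<ominus>\<^bsub>H\<^esub> z"]
      by (simp add: hdist_def)
  qed
qed

end

locale hilbert_space = inner_product_space +
  assumes complete: mcomplete

text \<open>\<^locale>\<open>group_action\<close> makes every \<open>\<alpha> g\<close> a bijection of the carrier.\<close>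

locale affine_isometric_action = hilbert_space H ip + group_action G "carrier H" \<alpha>
  for G :: "('a, 'b) monoid_scheme" and H :: "(real, 'h) module" and ip and \<alpha> +
  assumes affine: "\<lbrakk>g \<in> carrier G; x \<in> carrier H; y \<in> carrier H\<rbrakk> \<Longrightarrow>
      \<alpha> g ((1 - t) \<odot>\<^bsub>H\<^esub> x \<oplus>\<^bsub>H\<^esub> t \<odot>\<^bsub>H\<^esub> y) = (1 - t) \<odot>\<^bsub>H\<^esub> \<alpha> g x \<oplus>\<^bsub>H\<^esub> t \<odot>\<^bsub>H\<^esub> \<alpha> g y"
    and isometric: "\<lbrakk>g \<in> carrier G; x \<in> carrier H; y \<in> carrier H\<rbrakk> \<Longrightarrow>
      hdist (\<alpha> g x) (\<alpha> g y) = hdist x y"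

locale proper_affine_isometric_action = affine_isometric_action +
  assumes proper: "mbounded B \<Longrightarrow> finite {g \<in> carrier G. \<alpha> g ` B \<inter> B \<noteq> {}}"

text \<open>
  HOL cannot quantify over types inside a formula, so the elements of the Hilbert space are drawn
  from one fixed type of the cardinality of the continuum; carrier, operations and inner product
  are arbitrary. For a countable group \<open>G\<close> this is no restriction: the closed linear
  span of the orbit of the origin is a \<open>G\<close>-invariant separable closed subspace \<open>L\<close>,
  the action on \<open>L\<close> is still proper, and for a sequence \<open>d\<close> dense in \<open>L\<close> the map
  \<open>x \<mapsto> (\<lambda>n. hdist x (d n))\<close> embeds \<open>L\<close> injectively into this type.
\<close>

definition haagerup :: "('a, 'b) monoid_scheme \<Rightarrow> bool" where
  "haagerup G \<longleftrightarrow>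
     (\<exists>(H :: (real, nat \<Rightarrow> real) module) ip \<alpha>. proper_affine_isometric_action G H ip \<alpha>)"

end

theory Submission
  imports Defs
begin

text \<open>
  Given a random nonempty connected subgraph as in (ii), condition on the invariant event
  \<open>p_conn \<omega> = 1\<close> and hang every remaining vertex on \<open>\<omega>\<close> along a path of decreasing distance to \<open>\<omega>\<close>.
  Two far apart vertices of the new graph are separated by a long path in a hanging tree, which is
  open with exponentially small probability, or have far apart roots in \<open>\<omega>\<close>; hence the
  connectivity threshold remains \<open>1\<close>.

  Given a spanning subgraph as in (i), the averaged two-point functions
  \<open>\<phi>\<^sub>p(x, y) = E[\<tau>\<^sub>p\<^sup>\<omega>(x, y)]\<close> are invariant, positive definite (\<open>\<tau>\<^sub>p\<close> averages indicators of equivalence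
  relations), vanish at infinity for \<open>p < 1\<close> since \<open>p_conn \<omega> = 1\<close>, and tend to \<open>1\<close> as \<open>p \<rightarrow> 1\<close> since \<open>\<omega>\<close> is
  connected. For \<open>p\<^sub>n \<rightarrow> 1\<close> fast enough, \<open>\<Sum>\<^sub>n 1 - \<phi>\<^sub>p\<^sub>n\<close> is a proper, conditionally negative definite
  kernel, and it is the squared norm of the cocycle of an affine isometric action. The Hilbert space
  is realised as the dual of the finitely supported measures of total mass zero: a space of functions,
  complete by construction, whose norm satisfies the parallelogram law.
\<close>

section \<open>The Hilbert space of a conditionally positive kernel\<close>

text \<open>The vectors allowed in \<open>haagerup\<close> have the fixed type
  \<open>nat \<Rightarrow> real\<close>. The group is therefore enumerated and its kernels are read
  on indices in \<open>nat\<close>. A quotient by null vectors followed by a completion would change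
  the type, whereas bounded functionals, recorded by their values at points, are already functions
  of the index.

  Percolation on \<omega> lives on a product indexed by the edges of \<omega>, and \<omega> is
  itself random. One family of uniform labels, indexed by all sets of vertices, replaces all these
  spaces; on it the two-point function is monotone in p and measurable in \<omega>.

  Walks in \<omega> are walks in the Cayley graph, so decay in the metric of \<omega> forces decay
  at infinity of the group. The rate depends on \<omega>, hence the expectation is treated by
  dominated convergence and not by a uniform estimate. The convergence to 1 as p tends to 1 is not
  uniform over pairs either. The parameters are thus chosen diagonally, the n-th one handling only
  the elements with index at most n; this still makes the series converge for every single
  pair.\<close>

locale parallelogram_space =
  fixes C :: "('i \<Rightarrow> real) set" and N :: "('i \<Rightarrow> real) \<Rightarrow> real"
  assumes zero_mem: "(\<lambda>_. 0) \<in> C"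
    and add_mem: "f \<in> C \<Longrightarrow> g \<in> C \<Longrightarrow> (\<lambda>x. f x + g x) \<in> C"
    and scale_mem: "f \<in> C \<Longrightarrow> (\<lambda>x. r * f x) \<in> C"
    and N_nonneg: "f \<in> C \<Longrightarrow> 0 \<le> N f"
    and N_scale: "f \<in> C \<Longrightarrow> N (\<lambda>x. r * f x) = r\<^sup>2 * N f"
    and N_parallelogram: "f \<in> C \<Longrightarrow> g \<in> C \<Longrightarrow>
      N (\<lambda>x. f x + g x) + N (\<lambda>x. f x - g x) = 2 * N f + 2 * N g"
begin

definition inner where
  "inner f g = (N (\<lambda>x. f x + g x) - N (\<lambda>x. f x - g x)) / 4"

lemma diff_mem: "f \<in> C \<Longrightarrow> g \<in> C \<Longrightarrow> (\<lambda>x. f x - g x) \<in> C"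
  using add_mem[of f "\<lambda>x. (-1) * g x"] scale_mem[of g "-1"] by simp

lemma N_zero: "N (\<lambda>_. 0) = 0"
  using N_scale[OF zero_mem, of 0] by simp

lemma N_minus: "f \<in> C \<Longrightarrow> N (\<lambda>x. - f x) = N f"
  using N_scale[of f "-1"] by simp

lemma inner_self: "f \<in> C \<Longrightarrow> inner f f = N f"
  using N_scale[of f 2] by (simp add: inner_def N_zero)

lemma N_diff_commute:
  assumes "f \<in> C" "g \<in> C"
  shows "N (\<lambda>x. f x - g x) = N (\<lambda>x. g x - f x)"
  using N_minus[OF diff_mem[OF assms]] by simp

lemma inner_commute: "f \<in> C \<Longrightarrow> g \<in> C \<Longrightarrow> inner f g = inner g f"
  unfolding inner_def using N_diff_commute[of f g] by (simp add: add.commute)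

lemma inner_zero_left: "g \<in> C \<Longrightarrow> inner (\<lambda>_. 0) g = 0"
  by (simp add: inner_def N_minus)

text \<open>The core of the Jordan-von Neumann argument: the parallelogram law is applied to the
  pairs \<open>f + g\<close>, \<open>h\<close> and \<open>f - g\<close>, \<open>h\<close>, and the
  terms \<open>2 * N h\<close> cancel in the difference.\<close>

lemma inner_add_diff:
  assumes "f \<in> C" "h \<in> C" "g \<in> C"
  shows "inner (\<lambda>x. f x + h x) g + inner (\<lambda>x. f x - h x) g = 2 * inner f g"
proof -
  have "N (\<lambda>x. f x + h x + g x) + N (\<lambda>x. f x - h x + g x) = 2 * N (\<lambda>x. f x + g x) + 2 * N h"
    using N_parallelogram[OF add_mem[OF assms(1,3)] assms(2)] by (simp add: algebra_simps)
  moreover have "N (\<lambda>x. f x + h x - g x) + N (\<lambda>x. f x - h x - g x) = 2 * N (\<lambda>x. f x - g x) + 2 * N h"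
    using N_parallelogram[OF diff_mem[OF assms(1,3)] assms(2)] by (simp add: algebra_simps)
  moreover have "(a - b) / 4 + (c - d) / 4 = 2 * ((e - e') / 4)"
    if "a + c = 2 * e + 2 * k" "b + d = 2 * e' + 2 * k" for a b c d e e' k :: real
    using that by (simp add: field_simps)
  ultimately show ?thesis unfolding inner_def by blast
qed

lemma inner_double: "f \<in> C \<Longrightarrow> g \<in> C \<Longrightarrow> inner (\<lambda>x. 2 * f x) g = 2 * inner f g"
  using inner_add_diff[of f f g] by (simp add: inner_zero_left)

lemma inner_add_left:
  assumes "f \<in> C" "h \<in> C" "g \<in> C"
  shows "inner (\<lambda>x. f x + h x) g = inner f g + inner h g"
proof -
  \<comment> \<open>Sum and difference of \<open>u\<close> and \<open>w\<close> are \<open>f\<close>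
    and \<open>h\<close>, so \<open>inner_add_diff\<close> for this pair becomes additivity once
    doubling is known.\<close>
  define u where "u = (\<lambda>x. (1/2) * (f x + h x))"
  define w where "w = (\<lambda>x. (1/2) * (f x - h x))"
  have mem: "u \<in> C" "w \<in> C"
    unfolding u_def w_def
    by (rule scale_mem[OF add_mem[OF assms(1,2)]], rule scale_mem[OF diff_mem[OF assms(1,2)]])
  have *: "(\<lambda>x. u x + w x) = f" "(\<lambda>x. u x - w x) = h" "(\<lambda>x. 2 * u x) = (\<lambda>x. f x + h x)"
    by (auto simp: u_def w_def field_simps)
  show ?thesis using inner_add_diff[OF mem assms(3)] inner_double[OF mem(1) assms(3)]
    by (simp add: *)
qed

text \<open>Weaker than Cauchy-Schwarz, but available before homogeneity, which it serves to prove: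
  it bounds the defect of homogeneity over one period.\<close>

lemma inner_bound:
  assumes "f \<in> C" "g \<in> C"
  shows "\<bar>inner f g\<bar> \<le> (N f + N g) / 2"
  using N_parallelogram[OF assms] N_nonneg[OF add_mem[OF assms]] N_nonneg[OF diff_mem[OF assms]]
  unfolding inner_def by (simp add: abs_le_iff)

text \<open>The defect of homogeneity is additive in the scalar and vanishes on integers, hence it is
  periodic; being bounded on a period and additive, it is zero.\<close>

lemma inner_scale_left:
  assumes "f \<in> C" "g \<in> C"
  shows "inner (\<lambda>x. r * f x) g = r * inner f g"
proof -
  define A where "A t = inner (\<lambda>x. t * f x) g - t * inner f g" for t
  have add: "A (s + t) = A s + A t" for s t
    using inner_add_left[OF scale_mem scale_mem, of f f g s t] assms
    by (simp add: A_def algebra_simps)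
  have nat: "A (real n * t) = real n * A t" for n t
    by (induction n) (use add[of 0 0] add in \<open>simp_all add: algebra_simps\<close>)
  have one: "A 1 = 0" by (simp add: A_def)
  have zero: "A 0 = 0" using nat[of 0 1] by simp
  have minus: "A (- t) = - A t" for t using add[of t "-t"] zero by simp
  have int: "A (of_int k) = 0" for k
  proof (cases "k \<ge> 0")
    case True then show ?thesis using nat[of "nat k" 1] one by simp
  next
    case False then show ?thesis using nat[of "nat (-k)" 1] one minus[of "of_int k"] by simp
  qed
  define M where "M = (N f + N g) / 2 + \<bar>inner f g\<bar>"
  have bd: "\<bar>A t\<bar> \<le> M" for t
  proof -
    have "A t = A (frac t)"
      using add[of "of_int \<lfloor>t\<rfloor>" "frac t"] int by (simp add: frac_def)
    moreover have "\<bar>A (frac t)\<bar> \<le> M"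
    proof -
      let ?s = "frac t"
      have s: "0 \<le> ?s" "?s \<le> 1" using frac_lt_1[of t] by (auto intro: less_imp_le)
      have "\<bar>inner (\<lambda>x. ?s * f x) g\<bar> \<le> (?s\<^sup>2 * N f + N g) / 2"
        using inner_bound[OF scale_mem[OF assms(1)] assms(2)] N_scale[OF assms(1)] by metis
      also have "\<dots> \<le> (N f + N g) / 2"
        using s N_nonneg[OF assms(1)] by (simp add: mult_left_le_one_le power_le_one)
      finally have "\<bar>inner (\<lambda>x. ?s * f x) g\<bar> \<le> (N f + N g) / 2" .
      moreover have "\<bar>?s * inner f g\<bar> \<le> \<bar>inner f g\<bar>"
        using s by (simp add: abs_mult mult_left_le_one_le)
      ultimately show ?thesis unfolding A_def M_def by linarith
    qed
    ultimately show ?thesis by simp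
  qed
  have "A r = 0"
  proof (rule ccontr)
    assume "A r \<noteq> 0"
    then obtain n where "real n * \<bar>A r\<bar> > M"
      using reals_Archimedean3[of "\<bar>A r\<bar>"] by auto
    moreover have "real n * \<bar>A r\<bar> \<le> M" using bd[of "real n * r"] nat[of n r] by (simp add: abs_mult)
    ultimately show False by simp
  qed
  then show ?thesis by (simp add: A_def)
qed

end

text \<open>A list of triples \<open>(a, x, y)\<close> stands for the finitely supported measure
  \<open>\<Sum> a (\<delta>\<^sub>x - \<delta>\<^sub>y)\<close> of total mass zero.\<close>

type_synonym 'i test = "(real \<times> 'i \<times> 'i) list"

definition ev :: "('i \<Rightarrow> real) \<Rightarrow> 'i test \<Rightarrow> real" where
  "ev f c = (\<Sum>(a, x, y)\<leftarrow>c. a * (f x - f y))"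

definition scale :: "real \<Rightarrow> 'i test \<Rightarrow> 'i test" where
  "scale r c = map (\<lambda>(a, t). (r * a, t)) c"

lemma ev_simps [simp]:
  "ev f [] = 0"
  "ev f ((a, x, y) # c) = a * (f x - f y) + ev f c"
  "ev f (c @ d) = ev f c + ev f d"
  by (simp_all add: ev_def)

lemma ev_scale [simp]: "ev f (scale r c) = r * ev f c"
  by (induction c) (auto simp: scale_def algebra_simps)

lemma ev_add: "ev (\<lambda>x. f x + g x) c = ev f c + ev g c"
  by (induction c) (auto simp: algebra_simps)

lemma ev_mult: "ev (\<lambda>x. r * f x) c = r * ev f c"
  by (induction c) (auto simp: algebra_simps)

lemma ev_diff: "ev (\<lambda>x. f x - g x) c = ev f c - ev g c"
  by (induction c) (auto simp: algebra_simps)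

lemma ev_const [simp]: "ev (\<lambda>x. r) c = 0"
  by (induction c) auto

lemma ev_map: "ev f (map (\<lambda>(a, x, y). (a, h x, h y)) c) = ev (\<lambda>x. f (h x)) c"
  by (induction c) auto

lemma ev_exchange: "ev (\<lambda>x. ev (\<lambda>y. P x y) d) c = ev (\<lambda>y. ev (\<lambda>x. P x y) c) d"
  by (induction c) (auto simp: ev_add ev_mult ev_diff algebra_simps)

lemma tendsto_ev:
  assumes "\<And>x. (\<lambda>n. f n x) \<longlonglongrightarrow> g x"
  shows "(\<lambda>n. ev (f n) c) \<longlonglongrightarrow> ev g c"
proof (induction c)
  case (Cons t c)
  obtain a x y where t: "t = (a, x, y)" by (cases t)
  show ?case unfolding t ev_simps by (intro tendsto_intros assms Cons)
qed simp

section \<open>The dual norm of a conditionally positive kernel\<close>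

locale cond_pos_kernel =
  fixes P :: "'i \<Rightarrow> 'i \<Rightarrow> real" and z :: 'i
  assumes P_sym: "P x y = P y x"
    and P_pos: "0 \<le> ev (\<lambda>x. ev (\<lambda>y. P x y) c) c"
begin

definition form :: "'i test \<Rightarrow> 'i test \<Rightarrow> real" where
  "form c d = ev (\<lambda>x. ev (\<lambda>y. P x y) d) c"

abbreviation "quad c \<equiv> form c c"

lemma form_sym: "form c d = form d c"
  unfolding form_def by (subst ev_exchange) (simp add: P_sym)

lemma form_append: "form (c @ c') d = form c d + form c' d" "form d (c @ c') = form d c + form d c'"
  by (simp_all add: form_def ev_add)

lemma form_scale: "form (scale r c) d = r * form c d" "form d (scale r c) = r * form d c"
  by (simp_all add: form_def ev_mult)

lemma quad_nonneg: "0 \<le> quad c"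
  by (simp add: form_def P_pos)

text \<open>Functions that are bounded as linear functionals on test measures, with the square of the
  dual norm; by scaling, the supremum of \<open>2 f(c) - q(c)\<close> is that of \<open>f(c)\<^sup>2 / q(c)\<close>.\<close>

definition dual :: "('i \<Rightarrow> real) set" where
  "dual = {f. f z = 0 \<and> bdd_above (range (\<lambda>c. 2 * ev f c - quad c))}"

definition norm2 :: "('i \<Rightarrow> real) \<Rightarrow> real" where
  "norm2 f = (SUP c. 2 * ev f c - quad c)"

lemma dualI: "f z = 0 \<Longrightarrow> (\<And>c. 2 * ev f c - quad c \<le> M) \<Longrightarrow> f \<in> dual"
  by (auto simp: dual_def bdd_above_def)

lemma norm2_le: "(\<And>c. 2 * ev f c - quad c \<le> M) \<Longrightarrow> norm2 f \<le> M"
  unfolding norm2_def by (rule cSUP_least) auto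

lemma norm2_ge: "f \<in> dual \<Longrightarrow> 2 * ev f c - quad c \<le> norm2 f"
  unfolding norm2_def dual_def by (auto intro: cSUP_upper)

lemma norm2_ge_scaled: 
  assumes "f \<in> dual" shows "2 * r * ev f c - r\<^sup>2 * quad c \<le> norm2 f"
  using norm2_ge[OF assms, of "scale r c"] by (simp add: form_scale power2_eq_square mult_ac)

lemma norm2_nonneg: "f \<in> dual \<Longrightarrow> 0 \<le> norm2 f"
  using norm2_ge[of f "[]"] by (simp add: form_def)

lemma dual_zero: "(\<lambda>_. 0) \<in> dual"
  using quad_nonneg by (intro dualI[of _ 0]) auto

lemma dual_add:
  assumes "f \<in> dual" "g \<in> dual"
  shows "(\<lambda>x. f x + g x) \<in> dual"
proof (rule dualI)
  show "f z + g z = 0" using assms by (simp add: dual_def)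
  \<comment> \<open>Tested on half of \<open>c\<close>, each functional pays only a quarter of
    \<open>quad c\<close>; twice the sum of the two bounds has exactly \<open>quad c\<close>
    left.\<close>
  show "2 * ev (\<lambda>x. f x + g x) c - quad c \<le> 2 * norm2 f + 2 * norm2 g" for c
    using norm2_ge_scaled[OF assms(1), of "1/2" c] norm2_ge_scaled[OF assms(2), of "1/2" c]
    by (simp add: ev_add power2_eq_square)
qed

lemma dual_scale_norm2:
  assumes "f \<in> dual"
  shows "(\<lambda>x. r * f x) \<in> dual" and "norm2 (\<lambda>x. r * f x) \<le> r\<^sup>2 * norm2 f"
proof -
  have *: "2 * ev (\<lambda>x. r * f x) c - quad c \<le> r\<^sup>2 * norm2 f" for c
  proof (cases "r = 0")
    case True then show ?thesis using quad_nonneg[of c] by (simp add: ev_mult)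
  next
    case False
    have "r\<^sup>2 * (2 * (1/r) * ev f c - (1/r)\<^sup>2 * quad c) \<le> r\<^sup>2 * norm2 f"
      by (intro mult_left_mono norm2_ge_scaled assms) auto
    then show ?thesis using False by (simp add: ev_mult algebra_simps power2_eq_square)
  qed
  show "(\<lambda>x. r * f x) \<in> dual" using assms by (intro dualI[OF _ *]) (simp add: dual_def)
  show "norm2 (\<lambda>x. r * f x) \<le> r\<^sup>2 * norm2 f" by (rule norm2_le[OF *])
qed

lemma norm2_scale:
  assumes "f \<in> dual"
  shows "norm2 (\<lambda>x. r * f x) = r\<^sup>2 * norm2 f"
proof (cases "r = 0")
  case True
  have "norm2 (\<lambda>_. 0) \<le> 0" using quad_nonneg by (intro norm2_le) auto
  then show ?thesis using True norm2_nonneg[OF dual_zero] by simp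
next
  case False
  have "r\<^sup>2 * norm2 (\<lambda>x. (1/r) * (r * f x)) \<le> r\<^sup>2 * ((1/r)\<^sup>2 * norm2 (\<lambda>x. r * f x))"
    by (intro mult_left_mono dual_scale_norm2(2) dual_scale_norm2(1) assms) auto
  then show ?thesis using False dual_scale_norm2(2)[OF assms, of r]
    by (simp add: power_divide)
qed

lemma dual_diff: "f \<in> dual \<Longrightarrow> g \<in> dual \<Longrightarrow> (\<lambda>x. f x - g x) \<in> dual"
  using dual_add[of f "\<lambda>x. (-1) * g x"] dual_scale_norm2(1)[of g "-1"] by simp

text \<open>Tests \<open>c\<close>, \<open>d\<close> for \<open>f + g\<close>, \<open>f - g\<close>
  become the tests \<open>(c + d)/2\<close>, \<open>(c - d)/2\<close> for \<open>f\<close>,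
  \<open>g\<close>, and the quadratic form on tests satisfies the parallelogram law.\<close>

lemma norm2_parallelogram_le:
  assumes "f \<in> dual" "g \<in> dual"
  shows "norm2 (\<lambda>x. f x + g x) + norm2 (\<lambda>x. f x - g x) \<le> 2 * norm2 f + 2 * norm2 g"
proof -
  have "(2 * ev (\<lambda>x. f x + g x) c - quad c) + (2 * ev (\<lambda>x. f x - g x) d - quad d)
      \<le> 2 * norm2 f + 2 * norm2 g" for c d
  proof -
    define u where "u = scale (1/2) (c @ d)"
    define w where "w = scale (1/2) (c @ scale (-1) d)"
    have "2 * (2 * ev f u - quad u) + 2 * (2 * ev g w - quad w)
        = (2 * ev (\<lambda>x. f x + g x) c - quad c) + (2 * ev (\<lambda>x. f x - g x) d - quad d)"
      unfolding u_def w_def form_scale form_append ev_scale ev_simps ev_add ev_diff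
      using form_sym[of c d] by (simp add: algebra_simps)
    moreover have "2 * (2 * ev f u - quad u) + 2 * (2 * ev g w - quad w) \<le> 2 * norm2 f + 2 * norm2 g"
      using norm2_ge[OF assms(1), of u] norm2_ge[OF assms(2), of w] by (intro add_mono) simp_all
    ultimately show ?thesis by (simp only:)
  qed
  then have "2 * ev (\<lambda>x. f x + g x) c - quad c
      \<le> 2 * norm2 f + 2 * norm2 g - (2 * ev (\<lambda>x. f x - g x) d - quad d)" for c d
    by (simp add: algebra_simps)
  from norm2_le[OF this]
  have "2 * ev (\<lambda>x. f x - g x) d - quad d \<le> 2 * norm2 f + 2 * norm2 g - norm2 (\<lambda>x. f x + g x)" for d
    by (simp add: algebra_simps)
  from norm2_le[OF this] show ?thesis by simp
qed

sublocale parallelogram_space dual norm2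
proof
  fix f g assume fg: "f \<in> dual" "g \<in> dual"
  \<comment> \<open>The reverse inequality is the same one for the pair \<open>f + g\<close>,
    \<open>f - g\<close>, whose sum and difference are \<open>2 f\<close> and
    \<open>2 g\<close>.\<close>
  have "norm2 (\<lambda>x. (f x + g x) + (f x - g x)) + norm2 (\<lambda>x. (f x + g x) - (f x - g x))
      \<le> 2 * norm2 (\<lambda>x. f x + g x) + 2 * norm2 (\<lambda>x. f x - g x)"
    using fg by (intro norm2_parallelogram_le dual_add dual_diff)
  moreover have "norm2 (\<lambda>x. (f x + g x) + (f x - g x)) = 4 * norm2 f"
    "norm2 (\<lambda>x. (f x + g x) - (f x - g x)) = 4 * norm2 g"
    using norm2_scale[OF fg(1), of 2] norm2_scale[OF fg(2), of 2] by simp_all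
  ultimately show "norm2 (\<lambda>x. f x + g x) + norm2 (\<lambda>x. f x - g x) = 2 * norm2 f + 2 * norm2 g"
    using norm2_parallelogram_le[OF fg] by simp
qed (auto simp: dual_zero dual_add dual_scale_norm2 norm2_nonneg norm2_scale)

lemma ev_bound:
  assumes "f \<in> dual"
  shows "(ev f c)\<^sup>2 \<le> norm2 f * quad c"
proof (cases "quad c = 0")
  case True
  have "ev f c = 0"
  proof (rule ccontr)
    assume "ev f c \<noteq> 0"
    then show False
      \<comment> \<open>When \<open>quad c = 0\<close> the bound is linear in the scaling factor;
        this factor makes its left side equal to \<open>norm2 f + 1\<close>.\<close>
      using norm2_ge_scaled[OF assms, of "(norm2 f + 1) / (2 * ev f c)" c] True by simp
  qed
  then show ?thesis using True by simp
next
  case False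
  then have "quad c > 0" using quad_nonneg[of c] by simp
  \<comment> \<open>This factor maximises the quadratic polynomial on the left of
    \<open>norm2_ge_scaled\<close>.\<close>
  then show ?thesis using norm2_ge_scaled[OF assms, of "ev f c / quad c" c]
    by (simp add: field_simps power2_eq_square)
qed

text \<open>Point evaluations are continuous, as in a reproducing kernel Hilbert space. Hence the
  norm is definite and Cauchy sequences converge pointwise.\<close>

lemma pointwise_bound: "f \<in> dual \<Longrightarrow> (f x)\<^sup>2 \<le> norm2 f * quad [(1, x, z)]"
  using ev_bound[of f "[(1, x, z)]"] by (simp add: dual_def)

lemma norm2_eq_zero: "f \<in> dual \<Longrightarrow> norm2 f = 0 \<Longrightarrow> f = (\<lambda>_. 0)"
  using pointwise_bound[of f] by auto

definition hspace :: "(real, 'i \<Rightarrow> real) module" where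
  "hspace = \<lparr>carrier = dual, monoid.mult = \<lambda>f g. f, one = \<lambda>_. 0,
     zero = \<lambda>_. 0, add = \<lambda>f g x. f x + g x, smult = \<lambda>r f x. r * f x\<rparr>"

lemma hspace_simps [simp]:
  "carrier hspace = dual" "\<zero>\<^bsub>hspace\<^esub> = (\<lambda>_. 0)"
  "f \<oplus>\<^bsub>hspace\<^esub> g = (\<lambda>x. f x + g x)" "r \<odot>\<^bsub>hspace\<^esub> f = (\<lambda>x. r * f x)"
  by (simp_all add: hspace_def)

lemma abelian_group_hspace: "abelian_group hspace"
proof (rule abelian_groupI)
  fix f assume "f \<in> carrier hspace"
  then show "\<exists>g\<in>carrier hspace. g \<oplus>\<^bsub>hspace\<^esub> f = \<zero>\<^bsub>hspace\<^esub>"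
    using scale_mem[of f "-1"] by (intro bexI[of _ "\<lambda>x. (-1) * f x"]) auto
qed (auto simp: add_mem zero_mem algebra_simps)

sublocale hs: inner_product_space hspace inner
proof (intro inner_product_space.intro moduleI inner_product_space_axioms.intro)
  show "cring (ring_of_type_algebra :: real ring)" by (rule cring_from_type_algebra)
  show "abelian_group hspace" by (rule abelian_group_hspace)
qed (auto simp: ring_of_type_algebra_def scale_mem algebra_simps inner_self N_nonneg
    inner_add_left inner_scale_left norm2_eq_zero intro: inner_commute)

lemma hspace_diff:
  assumes "f \<in> dual" "g \<in> dual"
  shows "f \<ominus>\<^bsub>hspace\<^esub> g = (\<lambda>x. f x - g x)"
proof -
  have "(\<lambda>x. - g x) \<in> dual" using scale_mem[OF assms(2), of "-1"] by simp
  then have "\<ominus>\<^bsub>hspace\<^esub> g = (\<lambda>x. - g x)"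
    using assms by (intro abelian_group.minus_equality[OF abelian_group_hspace]) auto
  then show ?thesis by (simp add: a_minus_def)
qed

lemma hdist_eq: "f \<in> dual \<Longrightarrow> g \<in> dual \<Longrightarrow> hs.hdist f g = sqrt (norm2 (\<lambda>x. f x - g x))"
  by (simp add: hs.hdist_def hspace_diff inner_self dual_diff)

text \<open>The limit is taken pointwise. Each \<open>ev\<close> depends on finitely many values, so
  \<open>norm2\<close> is a supremum of functionals continuous under pointwise convergence; a bound
  on \<open>norm2\<close> of \<open>f n - f m\<close> therefore survives the limit in
  \<open>m\<close>.\<close>

lemma hspace_complete: "hs.mcomplete"
  unfolding hs.mcomplete_def
proof (intro allI impI)
  fix f :: "nat \<Rightarrow> 'i \<Rightarrow> real" assume "hs.MCauchy f"
  then have rng: "range f \<subseteq> dual"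
    and cau: "\<And>e. e > 0 \<Longrightarrow> \<exists>K. \<forall>m n. K \<le> m \<longrightarrow> K \<le> n \<longrightarrow> hs.hdist (f m) (f n) < e"
    unfolding hs.MCauchy_def by (simp_all add: hspace_def)
  have mem: "f n \<in> dual" for n using rng by blast
  have cau2: "\<exists>K. \<forall>m\<ge>K. \<forall>n\<ge>K. norm2 (\<lambda>x. f m x - f n x) < e" if "e > 0" for e
    using cau[of "sqrt e"] that unfolding hdist_eq[OF mem mem] by simp
  have "Cauchy (\<lambda>n. f n x)" for x
  proof (rule metric_CauchyI)
    fix e :: real assume e: "e > 0"
    \<comment> \<open>Adding 1 keeps \<open>w\<close> positive, so that the tolerance
      \<open>e\<^sup>2 / w\<close> makes sense.\<close>
    define w where "w = quad [(1, x, z)] + 1"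
    have w: "w > 0" using quad_nonneg[of "[(1,x,z)]"] by (simp add: w_def)
    obtain K where K: "\<And>m n. m \<ge> K \<Longrightarrow> n \<ge> K \<Longrightarrow> norm2 (\<lambda>x. f m x - f n x) < e\<^sup>2 / w"
      using cau2[of "e\<^sup>2 / w"] e w by (metis divide_pos_pos zero_less_power)
    show "\<exists>M. \<forall>m\<ge>M. \<forall>n\<ge>M. dist (f m x) (f n x) < e"
    proof (intro exI[of _ K] allI impI)
      fix m n assume mn: "m \<ge> K" "n \<ge> K"
      have d: "(\<lambda>x. f m x - f n x) \<in> dual" by (intro dual_diff mem)
      have "(f m x - f n x)\<^sup>2 \<le> norm2 (\<lambda>x. f m x - f n x) * w"
        using pointwise_bound[OF d, of x] norm2_nonneg[OF d] by (simp add: w_def algebra_simps)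
      also have "\<dots> < e\<^sup>2" using K[OF mn] w by (simp add: field_simps)
      finally have "\<bar>f m x - f n x\<bar> < e" using e power2_less_imp_less[of "\<bar>f m x - f n x\<bar>" e] by simp
      then show "dist (f m x) (f n x) < e" by (simp add: dist_real_def)
    qed
  qed
  then have "\<exists>l. (\<lambda>n. f n x) \<longlonglongrightarrow> l" for x
    by (simp add: real_Cauchy_convergent convergent_def[symmetric])
  then obtain g where lim: "\<And>x. (\<lambda>n. f n x) \<longlonglongrightarrow> g x" by metis
  have diff_le: "2 * ev (\<lambda>x. f n x - g x) c - quad c \<le> e"
    if K: "\<And>m. m \<ge> K \<Longrightarrow> norm2 (\<lambda>x. f n x - f m x) < e" for n K e c
  proof (rule LIMSEQ_le_const2)
    show "(\<lambda>m. 2 * ev (\<lambda>x. f n x - f m x) c - quad c) \<longlonglongrightarrow> 2 * ev (\<lambda>x. f n x - g x) c - quad c"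
      by (intro tendsto_intros tendsto_ev lim)
    show "\<exists>M. \<forall>m\<ge>M. 2 * ev (\<lambda>x. f n x - f m x) c - quad c \<le> e"
      using norm2_ge[OF dual_diff[OF mem mem]] K by (meson less_imp_le order_trans)
  qed
  have z0: "g z = 0"
  proof (rule LIMSEQ_unique[OF lim])
    show "(\<lambda>n. f n z) \<longlonglongrightarrow> 0" using mem by (simp add: dual_def)
  qed
  have g: "g \<in> dual"
  proof -
    obtain K where K: "\<And>m n. m \<ge> K \<Longrightarrow> n \<ge> K \<Longrightarrow> norm2 (\<lambda>x. f m x - f n x) < 1"
      using cau2[of 1] by auto
    have "(\<lambda>x. f K x - g x) \<in> dual"
      using diff_le[OF K[OF order_refl]] mem z0 by (intro dualI[of _ 1]) (auto simp: dual_def)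
    from dual_diff[OF mem[of K] this] show ?thesis by simp
  qed
  show "\<exists>x. limitin hs.mtopology f x sequentially"
    unfolding hs.limit_metric_sequentially
  proof (intro exI[of _ g] conjI allI impI)
    fix e :: real assume e: "e > 0"
    \<comment> \<open>The limit preserves only weak inequalities; halving \<open>e\<close> leaves
      room for a strict one.\<close>
    obtain K where K: "\<And>m n. m \<ge> K \<Longrightarrow> n \<ge> K \<Longrightarrow> norm2 (\<lambda>x. f m x - f n x) < (e/2)\<^sup>2"
      using cau2[of "(e/2)\<^sup>2"] e by (metis half_gt_zero zero_less_power)
    show "\<exists>N. \<forall>n\<ge>N. f n \<in> carrier hspace \<and> hs.hdist (f n) g < e"
    proof (intro exI[of _ K] allI impI conjI)
      fix n assume n: "n \<ge> K"
      have "norm2 (\<lambda>x. f n x - g x) \<le> (e/2)\<^sup>2" by (intro norm2_le diff_le K n)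
      then have "hs.hdist (f n) g \<le> e/2"
        unfolding hdist_eq[OF mem g] using e by (intro real_le_lsqrt) auto
      then show "hs.hdist (f n) g < e" using e by simp
    qed (simp add: mem)
  qed (simp add: g)
qed

sublocale hs: hilbert_space hspace inner
  by unfold_locales (rule hspace_complete)

text \<open>The potential of the measure \<open>d\<close>, normalised at \<open>z\<close>: it
  represents the functional that sends \<open>c\<close> to \<open>form c d\<close>.\<close>

definition rep :: "'i test \<Rightarrow> 'i \<Rightarrow> real" where
  "rep d x = ev (\<lambda>y. P y x) d - ev (\<lambda>y. P y z) d"

lemma ev_rep: "ev (rep d) c = form c d"
proof -
  have "ev (rep d) c = ev (\<lambda>x. ev (\<lambda>y. P y x) d) c - ev (\<lambda>x. ev (\<lambda>y. P y z) d) c"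
    unfolding rep_def by (rule ev_diff)
  then show ?thesis by (simp add: form_def P_sym)
qed

text \<open>Expanding \<open>0 \<le> quad (d - c)\<close> gives the bound, and \<open>c = d\<close>
  attains it.\<close>

lemma
  shows rep_mem: "rep d \<in> dual" and norm2_rep: "norm2 (rep d) = quad d"
proof -
  have *: "2 * ev (rep d) c - quad c \<le> quad d" for c
    using quad_nonneg[of "d @ scale (-1) c"] form_sym[of c d]
    by (simp add: ev_rep form_append form_scale)
  show mem: "rep d \<in> dual" by (rule dualI[OF _ *]) (simp add: rep_def)
  show "norm2 (rep d) = quad d"
    using norm2_le[OF *] norm2_ge[OF mem, of d] by (simp add: ev_rep)
qed

end

section \<open>The affine isometric action attached to an invariant kernel\<close>

locale invariant_kernel = cond_pos_kernel P z + group G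
  for P :: "'i \<Rightarrow> 'i \<Rightarrow> real" and z and G (structure) +
  fixes \<beta> :: "'a \<Rightarrow> 'i \<Rightarrow> 'i"
  assumes act_mult: "g \<in> carrier G \<Longrightarrow> h \<in> carrier G \<Longrightarrow> \<beta> (g \<otimes> h) x = \<beta> g (\<beta> h x)"
    and act_one: "\<beta> \<one> x = x"
    and P_inv: "g \<in> carrier G \<Longrightarrow> P (\<beta> g x) (\<beta> g y) = P x y"
begin

text \<open>Test measures have mass zero, so functions count only modulo constants; subtracting the
  value at \<open>z\<close> returns to the representative that vanishes there.\<close>

definition lin :: "'a \<Rightarrow> ('i \<Rightarrow> real) \<Rightarrow> 'i \<Rightarrow> real" where
  "lin g f x = f (\<beta> (inv g) x) - f (\<beta> (inv g) z)"

definition cocycle :: "'a \<Rightarrow> 'i \<Rightarrow> real" where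
  "cocycle g = rep [(1, \<beta> g z, z)]"

definition aff :: "'a \<Rightarrow> ('i \<Rightarrow> real) \<Rightarrow> 'i \<Rightarrow> real" where
  "aff g f x = lin g f x + cocycle g x"

lemma act_inv [simp]:
  "g \<in> carrier G \<Longrightarrow> \<beta> g (\<beta> (inv g) x) = x" "g \<in> carrier G \<Longrightarrow> \<beta> (inv g) (\<beta> g x) = x"
  using act_mult[of g "inv g" x] act_mult[of "inv g" g x] by (simp_all add: act_one)

lemma P_shift: "g \<in> carrier G \<Longrightarrow> P x (\<beta> (inv g) y) = P (\<beta> g x) y"
  using P_inv[of g x "\<beta> (inv g) y"] by simp

text \<open>Moving a test by \<open>\<beta> (inv g)\<close> preserves \<open>quad\<close>, so the
  supremum cannot grow. Equality comes from the same bound for \<open>inv g\<close>.\<close>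

lemma lin_dual:
  assumes g: "g \<in> carrier G" and f: "f \<in> dual"
  shows "lin g f \<in> dual" and "norm2 (lin g f) \<le> norm2 f"
proof -
  have *: "2 * ev (lin g f) c - quad c \<le> norm2 f" for c
  proof -
    let ?d = "map (\<lambda>(a, x, y). (a, \<beta> (inv g) x, \<beta> (inv g) y)) c"
    have "ev (lin g f) c = ev (\<lambda>x. f (\<beta> (inv g) x)) c - ev (\<lambda>x. f (\<beta> (inv g) z)) c"
      unfolding lin_def by (rule ev_diff)
    then have "ev (lin g f) c = ev f ?d" by (simp add: ev_map)
    moreover have "quad ?d = quad c"
      unfolding form_def ev_map using g by (simp add: P_inv)
    ultimately show ?thesis using norm2_ge[OF f, of ?d] by simp
  qed
  show "lin g f \<in> dual" by (rule dualI[OF _ *]) (simp add: lin_def)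
  show "norm2 (lin g f) \<le> norm2 f" by (rule norm2_le[OF *])
qed

lemma lin_lin:
  assumes g: "g \<in> carrier G" and f: "f \<in> dual"
  shows "lin (inv g) (lin g f) = f"
  using assms f by (auto simp: lin_def dual_def)

lemma norm2_lin: "g \<in> carrier G \<Longrightarrow> f \<in> dual \<Longrightarrow> norm2 (lin g f) = norm2 f"
  using lin_dual(2)[of g f] lin_dual(2)[of "inv g" "lin g f"] lin_dual(1)[of g f] lin_lin[of g f]
  by force

lemma aff_mem: "g \<in> carrier G \<Longrightarrow> f \<in> dual \<Longrightarrow> aff g f \<in> dual"
  using add_mem[OF lin_dual(1) rep_mem] by (simp add: aff_def[abs_def] cocycle_def)

lemma aff_one: "f \<in> dual \<Longrightarrow> aff \<one> f = f"
  by (auto simp: aff_def lin_def cocycle_def act_one rep_def dual_def)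

lemma aff_mult:
  assumes "g \<in> carrier G" "h \<in> carrier G" "f \<in> dual"
  shows "aff (g \<otimes> h) f = aff g (aff h f)"
proof
  fix x
  have "aff g (aff h f) x = lin (g \<otimes> h) f x
      + (cocycle h (\<beta> (inv g) x) - cocycle h (\<beta> (inv g) z) + cocycle g x)"
    using assms by (simp add: aff_def lin_def inv_mult_group act_mult)
  \<comment> \<open>The cocycle identity. After \<open>P_shift\<close> the difference of point
    masses at \<open>\<beta> (g \<otimes> h) z\<close> and \<open>\<beta> g z\<close> is added to
    the one at \<open>\<beta> g z\<close> and \<open>z\<close>, and the sum telescopes.\<close>
  also have "cocycle h (\<beta> (inv g) x) - cocycle h (\<beta> (inv g) z) + cocycle g x = cocycle (g \<otimes> h) x"
    using assms by (simp add: cocycle_def rep_def P_shift act_mult)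
  finally show "aff (g \<otimes> h) f x = aff g (aff h f) x"
    unfolding aff_def[of "g \<otimes> h" f x] by (rule sym)
qed

lemma aff_bij: "g \<in> carrier G \<Longrightarrow> bij_betw (aff g) dual dual"
proof (rule bij_betw_byWitness[where f' = "aff (inv g)"])
  assume g: "g \<in> carrier G"
  show "\<forall>f\<in>dual. aff (inv g) (aff g f) = f"
    using g aff_mult[of "inv g" g] by (auto simp: aff_one)
  show "\<forall>f\<in>dual. aff g (aff (inv g) f) = f"
    using g aff_mult[of g "inv g"] by (auto simp: aff_one)
qed (auto intro: aff_mem)

lemma hdist_aff:
  assumes "g \<in> carrier G" "f \<in> dual" "h \<in> dual"
  shows "hs.hdist (aff g f) (aff g h) = hs.hdist f h"
proof -
  have "(\<lambda>x. aff g f x - aff g h x) = lin g (\<lambda>x. f x - h x)"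
    by (auto simp: aff_def lin_def)
  then show ?thesis using assms
    by (simp add: hdist_eq aff_mem norm2_lin dual_diff)
qed

text \<open>Elements of \<open>Bij\<close> are extensional, hence the restriction to
  \<open>dual\<close>.\<close>

definition act where "act g = restrict (aff g) dual"

lemma group_action_act: "group_action G (carrier hspace) act"
proof -
  have mem: "act g \<in> Bij dual" if "g \<in> carrier G" for g
    using aff_bij[OF that] by (auto simp: act_def Bij_def cong: bij_betw_cong)
  have "act \<in> hom G (BijGroup dual)"
  proof (rule homI)
    show "act g \<in> carrier (BijGroup dual)" if "g \<in> carrier G" for g
      using mem[OF that] by (simp add: BijGroup_def)
    fix g h assume gh: "g \<in> carrier G" "h \<in> carrier G"
    have "act (g \<otimes> h) = compose dual (act g) (act h)"
      using gh by (intro ext) (auto simp: act_def compose_def aff_mult aff_mem restrict_def)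
    then show "act (g \<otimes> h) = act g \<otimes>\<^bsub>BijGroup dual\<^esub> act h"
      using gh mem by (simp add: BijGroup_def)
  qed
  then show ?thesis
    by (simp add: group_action_def group_hom_def group_hom_axioms_def group_BijGroup is_group)
qed

sublocale act: affine_isometric_action G hspace inner act
proof (intro affine_isometric_action.intro affine_isometric_action_axioms.intro)
  show "hilbert_space hspace inner" by unfold_locales
  show "group_action G (carrier hspace) act" by (rule group_action_act)
  fix g f h assume gfh: "g \<in> carrier G" "f \<in> carrier hspace" "h \<in> carrier hspace"
  show "hs.hdist (act g f) (act g h) = hs.hdist f h"
    using gfh by (simp add: act_def hdist_aff)
  have mem: "(\<lambda>x. (1 - t) * f x + t * h x) \<in> dual" for t
    using gfh by (auto intro: add_mem scale_mem)
  show "act g ((1 - t) \<odot>\<^bsub>hspace\<^esub> f \<oplus>\<^bsub>hspace\<^esub> t \<odot>\<^bsub>hspace\<^esub> h)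
      = (1 - t) \<odot>\<^bsub>hspace\<^esub> act g f \<oplus>\<^bsub>hspace\<^esub> t \<odot>\<^bsub>hspace\<^esub> act g h" for t
    using gfh mem by (auto simp: act_def aff_def lin_def algebra_simps)
qed

text \<open>The left side is the displacement of the origin, and the displacements of two points
  under an isometry differ by at most twice their distance.\<close>

lemma norm_cocycle_le:
  assumes g: "g \<in> carrier G" and f: "f \<in> dual"
  shows "sqrt (quad [(1, \<beta> g z, z)]) \<le> hs.hdist (aff g f) f + 2 * hs.hdist f (\<lambda>_. 0)"
proof -
  have z: "aff g (\<lambda>_. 0) = cocycle g" by (auto simp: aff_def lin_def)
  have mem: "cocycle g \<in> dual" by (simp add: cocycle_def rep_mem)
  have "sqrt (quad [(1, \<beta> g z, z)]) = hs.hdist (aff g (\<lambda>_. 0)) (\<lambda>_. 0)"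
    by (simp add: z hdist_eq mem zero_mem) (simp add: cocycle_def norm2_rep)
  also have "\<dots> \<le> hs.hdist (aff g (\<lambda>_. 0)) (aff g f) + hs.hdist (aff g f) (\<lambda>_. 0)"
    using g f by (intro hs.triangle) (auto simp: aff_mem zero_mem)
  also have "hs.hdist (aff g (\<lambda>_. 0)) (aff g f) = hs.hdist f (\<lambda>_. 0)"
    using g f by (simp add: hdist_aff zero_mem hs.commute)
  also have "hs.hdist (aff g f) (\<lambda>_. 0) \<le> hs.hdist (aff g f) f + hs.hdist f (\<lambda>_. 0)"
    using g f by (intro hs.triangle) (auto simp: aff_mem zero_mem)
  finally show ?thesis by simp
qed

lemma proper_act:
  assumes fin: "\<And>M. finite {g \<in> carrier G. quad [(1, \<beta> g z, z)] \<le> M}"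
  shows "proper_affine_isometric_action G hspace inner act"
proof (intro proper_affine_isometric_action.intro proper_affine_isometric_action_axioms.intro)
  show "affine_isometric_action G hspace inner act" by unfold_locales
  fix B assume "hs.mbounded B"
  then obtain R where B: "B \<subseteq> dual" and R: "\<And>f g. f \<in> B \<Longrightarrow> g \<in> B \<Longrightarrow> hs.hdist f g \<le> R"
    unfolding hs.mbounded_alt by auto
  show "finite {g \<in> carrier G. act g ` B \<inter> B \<noteq> {}}"
  proof (cases "B = {}")
    case False
    then obtain b where b: "b \<in> B" by auto
    \<comment> \<open>If \<open>f\<close> and its image both lie in \<open>B\<close>, then
      \<open>f\<close> moves by at most \<open>R\<close> and lies within
      \<open>R + hs.hdist b 0\<close> of the origin; \<open>norm_cocycle_le\<close> combines the
      two.\<close>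
    define R' where "R' = R + 2 * (R + hs.hdist b (\<lambda>_. 0))"
    have "quad [(1, \<beta> g z, z)] \<le> R'\<^sup>2" if g: "g \<in> carrier G" and f: "f \<in> B" "act g f \<in> B" for g f
    proof -
      have fd: "f \<in> dual" using f B by auto
      have "hs.hdist f (\<lambda>_. 0) \<le> hs.hdist f b + hs.hdist b (\<lambda>_. 0)"
        using fd b B by (intro hs.triangle) (auto simp: zero_mem)
      also have "\<dots> \<le> R + hs.hdist b (\<lambda>_. 0)" using R[OF f(1) b] by simp
      finally have "sqrt (quad [(1, \<beta> g z, z)]) \<le> R'"
        using norm_cocycle_le[OF g fd] R[OF f(2,1)] fd by (simp add: act_def R'_def)
      then show ?thesis using sqrt_le_D by blast
    qed
    then have "{g \<in> carrier G. act g ` B \<inter> B \<noteq> {}} \<subseteq> {g \<in> carrier G. quad [(1, \<beta> g z, z)] \<le> R'\<^sup>2}"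
      by blast
    then show ?thesis using fin finite_subset by blast
  qed auto
qed

end

section \<open>Uniform edge labels\<close>

text \<open>The random edge set \<open>E\<close> is left general because it occurs as a percolation
  configuration, as a labelled graph, as a random subgraph, and as a mixture of the last two.
  Splitting by the penultimate vertex gives a countable union.\<close>

lemma relpow_adj_measurable:
  assumes V: "countable V" and sub: "\<And>x e. x \<in> space M \<Longrightarrow> e \<in> E x \<Longrightarrow> e \<subseteq> V"
    and meas: "\<And>w v. {x \<in> space M. {w, v} \<in> E x} \<in> sets M"
  shows "{x \<in> space M. (u, v) \<in> adj (E x) ^^ n} \<in> sets M"
proof (induction n arbitrary: v)
  case 0
  then show ?case by (cases "u = v") auto
next
  case (Suc n)
  have "{x \<in> space M. (u, v) \<in> adj (E x) ^^ Suc n}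
      = (\<Union>w\<in>V. {x \<in> space M. (u, w) \<in> adj (E x) ^^ n} \<inter> {x \<in> space M. {w, v} \<in> E x})"
    using sub by (auto simp: adj_def relcomp_unfold)
  also have "\<dots> \<in> sets M"
    using V Suc meas by (intro sets.countable_UN' sets.Int) auto
  finally show ?case .
qed

lemma rtrancl_adj_measurable:
  assumes "countable V" and "\<And>x e. x \<in> space M \<Longrightarrow> e \<in> E x \<Longrightarrow> e \<subseteq> V"
    and "\<And>w v. {x \<in> space M. {w, v} \<in> E x} \<in> sets M"
  shows "{x \<in> space M. (u, v) \<in> (adj (E x))\<^sup>*} \<in> sets M"
proof -
  have "{x \<in> space M. (u, v) \<in> (adj (E x))\<^sup>*} = (\<Union>n. {x \<in> space M. (u, v) \<in> adj (E x) ^^ n})"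
    by (auto simp: rtrancl_is_UN_relpow)
  also have "\<dots> \<in> sets M"
    using relpow_adj_measurable[OF assms] by auto
  finally show ?thesis .
qed

lemma adj_mono: "E \<subseteq> F \<Longrightarrow> (u, v) \<in> (adj E)\<^sup>* \<Longrightarrow> (u, v) \<in> (adj F)\<^sup>*"
  using rtrancl_mono[of "adj E" "adj F"] by (auto simp: adj_def)

lemma sym_adj: "sym (adj E)"
  by (auto simp: adj_def sym_def insert_commute)

lemma rtrancl_adj_sym: "(u, v) \<in> (adj E)\<^sup>* \<longleftrightarrow> (v, u) \<in> (adj E)\<^sup>*"
  by (meson sym_rtrancl[OF sym_adj] symD)

definition uniform01 :: "real measure" where
  "uniform01 = uniform_measure lborel {0..1}"

definition labels :: "('v set \<Rightarrow> real) measure" where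
  "labels = Pi\<^sub>M UNIV (\<lambda>_. uniform01)"

lemma sets_uniform01 [measurable_cong, simp]: "sets uniform01 = sets borel"
  by (simp add: uniform01_def)

lemma space_uniform01 [simp]: "space uniform01 = UNIV"
  by (simp add: uniform01_def)

lemma prob_space_uniform01: "prob_space uniform01"
  unfolding uniform01_def by (rule prob_space_uniform_measure) auto

lemma measure_uniform01: "0 \<le> p \<Longrightarrow> p \<le> 1 \<Longrightarrow> measure uniform01 {..p} = p"
proof -
  assume p: "0 \<le> p" "p \<le> 1"
  have "{0..1} \<inter> {..p} = {0..p}" using p by auto
  then show ?thesis using p by (simp add: uniform01_def)
qed

lemma measure_uniform01_gt: "0 \<le> p \<Longrightarrow> p \<le> 1 \<Longrightarrow> measure uniform01 {p<..} = 1 - p"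
  using prob_space.prob_compl[OF prob_space_uniform01, of "{..p}"] measure_uniform01[of p]
  by (simp add: Compl_eq_Diff_UNIV[symmetric] not_le)

lemma space_labels [simp]: "space labels = UNIV"
  by (auto simp: labels_def space_PiM)

interpretation label_product: product_prob_space "\<lambda>_. uniform01" UNIV
  by (simp add: product_prob_space_def product_prob_space_axioms_def product_sigma_finite_def
      prob_space_uniform01 prob_space_imp_sigma_finite)

lemma prob_space_labels: "prob_space labels"
  unfolding labels_def by (rule prob_space_PiM) (rule prob_space_uniform01)

interpretation labels: prob_space labels by (rule prob_space_labels)

lemma label_measurable [measurable]: "(\<lambda>x. x e) \<in> borel_measurable labels"
proof -
  have "(\<lambda>x. x e) \<in> measurable labels uniform01"
    unfolding labels_def by (rule measurable_component_singleton) simp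
  then show ?thesis by (simp cong: measurable_cong_sets)
qed

lemma measure_labels_box:
  assumes "finite J" "\<And>j. j \<in> J \<Longrightarrow> D j \<in> sets borel"
  shows "measure labels {x. \<forall>j\<in>J. x j \<in> D j} = (\<Prod>j\<in>J. measure uniform01 (D j))"
proof -
  have "{x. \<forall>j\<in>J. x j \<in> D j} = prod_emb UNIV (\<lambda>_. uniform01) J (Pi\<^sub>E J D)"
    by (auto simp: prod_emb_def space_PiM PiE_iff)
  then show ?thesis
    using label_product.measure_PiM_emb[of J D] assms by (simp add: labels_def)
qed

lemma bernoulli_distr:
  assumes p: "0 \<le> p" "p \<le> 1"
  shows "measure uniform01 {y. (y \<le> p) \<in> A} = measure (measure_pmf (bernoulli_pmf p)) A"
proof -
  have A_eq: "A = {b. (b \<and> True \<in> A) \<or> (\<not> b \<and> False \<in> A)}"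
  proof (rule Set.set_eqI)
    show "b \<in> A \<longleftrightarrow> b \<in> {b. (b \<and> True \<in> A) \<or> (\<not> b \<and> False \<in> A)}" for b by (cases b) auto
  qed
  have s: "{y. y \<le> p} = {..p}" "{y. \<not> y \<le> p} = {p<..}" "{b. b} = {True}" "{b. \<not> b} = {False}"
    by auto
  have u: "measure uniform01 UNIV = 1"
    using prob_space.prob_space[OF prob_space_uniform01] by simp
  have "measure uniform01 {y. (y \<le> p \<and> a) \<or> (\<not> y \<le> p \<and> b)}
      = measure (measure_pmf (bernoulli_pmf p)) {c. (c \<and> a) \<or> (\<not> c \<and> b)}" for a b
    by (cases a; cases b) (simp_all add: s u p measure_uniform01 measure_uniform01_gt measure_pmf_single)
  from this[of "True \<in> A" "False \<in> A"] show ?thesis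
    by (subst (1 2) A_eq) simp
qed

text \<open>A percolation configuration is obtained by keeping the edges with label at most \<open>p\<close>, where
  the edge \<open>e\<close> reads its label at \<open>f e\<close>. This couples all values of \<open>p\<close> and all graphs.\<close>

lemma bond_percolation_eq_distr:
  fixes H :: "'v graph" and f :: "'v set \<Rightarrow> 'v set"
  assumes p: "0 \<le> p" "p \<le> 1" and f: "inj_on f (snd H)"
  shows "distr labels (bond_percolation p H) (\<lambda>x. \<lambda>e\<in>snd H. x (f e) \<le> p) = bond_percolation p H"
    and "(\<lambda>x. \<lambda>e\<in>snd H. x (f e) \<le> p) \<in> measurable labels (bond_percolation p H)"
proof -
  let ?B = "measure_pmf (bernoulli_pmf p)" and ?t = "\<lambda>x. \<lambda>e\<in>snd H. x (f e) \<le> p"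
  show t: "?t \<in> measurable labels (bond_percolation p H)"
    unfolding bond_percolation_def
    by (rule measurable_restrict) (simp add: measurable_cong_sets[OF refl sets_measure_pmf_count_space])
  show "distr labels (bond_percolation p H) ?t = bond_percolation p H"
    unfolding bond_percolation_def
  proof (rule measure_eqI_PiM_infinite[symmetric, OF refl])
    interpret B: prob_space "Pi\<^sub>M (snd H) (\<lambda>_. ?B)"
      by (rule prob_space_PiM) (rule measure_pmf.prob_space_axioms)
    show "finite_measure (Pi\<^sub>M (snd H) (\<lambda>_. ?B))" by unfold_locales
    show "sets (distr labels (Pi\<^sub>M (snd H) (\<lambda>_. ?B)) ?t) = sets (Pi\<^sub>M (snd H) (\<lambda>_. ?B))" by simp
    fix A J assume J: "finite J" "J \<subseteq> snd H" and A: "\<And>e. e \<in> J \<Longrightarrow> A e \<in> sets ?B"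
    let ?E = "prod_emb (snd H) (\<lambda>_. ?B) J (Pi\<^sub>E J A)"
    have inj: "inj_on f J" using f J by (auto intro: inj_on_subset)
    \<comment> \<open>Independence is available for labels listed by their own index, so the box
      over \<open>J\<close> is rewritten over the image of \<open>J\<close> under \<open>f\<close>;
      injectivity ensures that no label is read twice.\<close>
    have "{x. \<forall>e\<in>J. (x (f e) \<le> p) \<in> A e}
        = {x. \<forall>k\<in>f ` J. x k \<in> {y. (y \<le> p) \<in> A (the_inv_into J f k)}}"
      using inj by (auto simp: the_inv_into_f_f)
    moreover have "{y::real. (y \<le> p) \<in> D} \<in> sets borel" for D
      by measurable
    ultimately have "measure labels {x. \<forall>e\<in>J. (x (f e) \<le> p) \<in> A e}
        = (\<Prod>k\<in>f ` J. measure uniform01 {y. (y \<le> p) \<in> A (the_inv_into J f k)})"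
      using J measure_labels_box[of "f ` J" "\<lambda>k. {y. (y \<le> p) \<in> A (the_inv_into J f k)}"] by simp
    also have "\<dots> = (\<Prod>e\<in>J. measure uniform01 {y. (y \<le> p) \<in> A e})"
      using inj by (simp add: prod.reindex the_inv_into_f_f)
    also have "\<dots> = (\<Prod>e\<in>J. measure ?B (A e))"
      using p by (simp add: bernoulli_distr)
    finally have *: "measure labels {x. \<forall>e\<in>J. (x (f e) \<le> p) \<in> A e} = (\<Prod>e\<in>J. measure ?B (A e))" .
    have "emeasure (Pi\<^sub>M (snd H) (\<lambda>_. ?B)) ?E = (\<Prod>e\<in>J. emeasure ?B (A e))"
      using J A by (intro emeasure_PiM_emb) (auto intro: measure_pmf.prob_space_axioms)
    also have "\<dots> = ennreal (\<Prod>e\<in>J. measure ?B (A e))"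
      by (simp add: measure_pmf.emeasure_eq_measure prod_ennreal)
    also have "\<dots> = emeasure labels {x. \<forall>e\<in>J. (x (f e) \<le> p) \<in> A e}"
      by (simp add: labels.emeasure_eq_measure *)
    also have "{x. \<forall>e\<in>J. (x (f e) \<le> p) \<in> A e} = ?t -` ?E \<inter> space labels"
    proof -
      have "?t x e = (x (f e) \<le> p)" if "e \<in> J" for x e using J that by auto
      then show ?thesis by (auto simp: prod_emb_iff PiE_iff)
    qed
    also have "emeasure labels \<dots> = emeasure (distr labels (Pi\<^sub>M (snd H) (\<lambda>_. ?B)) ?t) ?E"
      using t J A unfolding bond_percolation_def
      by (subst emeasure_distr) (auto intro!: sets_PiM_I)
    finally show "emeasure (Pi\<^sub>M (snd H) (\<lambda>_. ?B)) ?E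
        = emeasure (distr labels (Pi\<^sub>M (snd H) (\<lambda>_. ?B)) ?t) ?E" .
  qed
qed

text \<open>The choice of \<open>f\<close> is left open for two uses: the identity yields
  \<open>tau\<close>, and the inverse of a vertex map acting on edges yields invariance under
  relabelling.\<close>

lemma two_point_eq_labels:
  fixes H :: "'v graph" and f :: "'v set \<Rightarrow> 'v set"
  assumes p: "0 \<le> p" "p \<le> 1" and f: "inj_on f (snd H)"
    and V: "countable V" "\<And>e. e \<in> snd H \<Longrightarrow> e \<subseteq> V"
  shows "two_point H p u v = measure labels {x. (u, v) \<in> (adj {e \<in> snd H. x (f e) \<le> p})\<^sup>*}"
proof -
  let ?M = "bond_percolation p H" and ?t = "\<lambda>x. \<lambda>e\<in>snd H. x (f e) \<le> p"
  let ?S = "{x \<in> space ?M. (u, v) \<in> (adj {e \<in> snd H. x e})\<^sup>*}"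
  have "{x \<in> space ?M. x e} \<in> sets ?M" if "e \<in> snd H" for e
  proof -
    have "(\<lambda>x. x e) \<in> measurable ?M (measure_pmf (bernoulli_pmf p))"
      unfolding bond_percolation_def using that by (rule measurable_component_singleton)
    from measurable_sets[OF this, of "{True}"] show ?thesis by (simp add: vimage_def Int_def conj_commute)
  qed
  then have "{x \<in> space ?M. {w, v} \<in> {e \<in> snd H. x e}} \<in> sets ?M" for w v
    by (cases "{w, v} \<in> snd H") auto
  then have S: "?S \<in> sets ?M" using V by (intro rtrancl_adj_measurable[of V]) auto
  have "two_point H p u v = measure (distr labels ?M ?t) ?S"
    unfolding two_point_def bond_percolation_eq_distr(1)[OF p f] ..
  also have "\<dots> = measure labels (?t -` ?S \<inter> space labels)"
    by (rule measure_distr[OF bond_percolation_eq_distr(2)[OF p f] S])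
  also have "?t -` ?S \<inter> space labels = {x. (u, v) \<in> (adj {e \<in> snd H. x (f e) \<le> p})\<^sup>*}"
  proof -
    have "?t x \<in> space ?M" for x
      by (auto simp: bond_percolation_def space_PiM)
    moreover have "{e \<in> snd H. ?t x e} = {e \<in> snd H. x (f e) \<le> p}" for x by auto
    ultimately show ?thesis by auto
  qed
  finally show ?thesis .
qed

section \<open>The two-point function on the common label space\<close>

definition tau :: "'v set set \<Rightarrow> real \<Rightarrow> 'v \<Rightarrow> 'v \<Rightarrow> real" where
  "tau E p u v = measure labels {x. (u, v) \<in> (adj {e \<in> E. x e \<le> p})\<^sup>*}"

lemma tau_nonneg [simp]: "0 \<le> tau E p u v"
  by (simp add: tau_def)

lemma tau_le_1 [simp]: "tau E p u v \<le> 1"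
  by (simp add: tau_def)

lemma tau_refl [simp]: "tau E p u u = 1"
  using labels.prob_space by (simp add: tau_def)

lemma tau_sym: "tau E p u v = tau E p v u"
  unfolding tau_def by (subst rtrancl_adj_sym) simp

lemma two_point_eq_tau:
  assumes "0 \<le> p" "p \<le> 1" "countable V" "\<And>e. e \<in> snd H \<Longrightarrow> e \<subseteq> V"
  shows "two_point H p u v = tau (snd H) p u v"
  using two_point_eq_labels[OF assms(1,2) inj_on_id2 assms(3,4)] by (simp add: tau_def)

lemma connected_event [measurable]:
  assumes "countable V" "\<And>e. e \<in> E \<Longrightarrow> e \<subseteq> V"
  shows "{x. (u, v) \<in> (adj {e \<in> E. x e \<le> p})\<^sup>*} \<in> sets labels"
proof -
  have "{x \<in> space labels. {w, v} \<in> {e \<in> E. x e \<le> p}} \<in> sets labels" for w v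
  proof (cases "{w, v} \<in> E")
    case True
    have "{x \<in> space labels. x {w, v} \<le> p} \<in> sets labels" by measurable
    then show ?thesis using True by simp
  qed simp
  from rtrancl_adj_measurable[OF assms(1) _ this] show ?thesis
    using assms(2) by auto
qed

lemma tau_mono:
  assumes "countable V" "\<And>e. e \<in> E \<Longrightarrow> e \<subseteq> V" "p \<le> q"
  shows "tau E p u v \<le> tau E q u v"
  unfolding tau_def
proof (rule labels.finite_measure_mono)
  show "{x. (u, v) \<in> (adj {e \<in> E. x e \<le> q})\<^sup>*} \<in> sets labels"
    by (rule connected_event[OF assms(1,2)])
qed (use assms(3) in \<open>auto elim!: adj_mono[rotated]\<close>)

lemma adj_image_relpow:
  assumes g: "inj_on g V" and E: "\<And>e. e \<in> E \<Longrightarrow> e \<subseteq> V" and u: "u \<in> V" and v: "v \<in> V"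
  shows "(g u, g v) \<in> adj ((`) g ` E) ^^ n \<longleftrightarrow> (u, v) \<in> adj E ^^ n"
  using v
proof (induction n arbitrary: v)
  case 0
  then show ?case using g u by (auto dest: inj_onD)
next
  case (Suc n)
  have e: "{g w, g v} \<in> (`) g ` E \<longleftrightarrow> {w, v} \<in> E" if "w \<in> V" for w
  proof
    assume "{g w, g v} \<in> (`) g ` E"
    then obtain e where e: "e \<in> E" "g ` {w, v} = g ` e" by auto
    moreover have "{w, v} \<subseteq> V" "e \<subseteq> V" using that Suc.prems E e by auto
    ultimately have "{w, v} = e" using inj_on_image_eq_iff[OF g] by blast
    then show "{w, v} \<in> E" using e by simp
  qed (auto intro: image_eqI[of _ _ "{w, v}"])
  show ?case
  proof
    assume "(g u, g v) \<in> adj ((`) g ` E) ^^ Suc n"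
    then obtain y where y: "(g u, y) \<in> adj ((`) g ` E) ^^ n" "{y, g v} \<in> (`) g ` E"
      by (auto simp: adj_def relcomp_unfold)
    then obtain e where "e \<in> E" "y \<in> g ` e" by blast
    then obtain w where w: "w \<in> V" "y = g w" using E by blast
    then show "(u, v) \<in> adj E ^^ Suc n"
      using y e[OF w(1)] Suc.IH[OF w(1)] by (auto simp: adj_def)
  next
    assume "(u, v) \<in> adj E ^^ Suc n"
    then obtain w where w: "(u, w) \<in> adj E ^^ n" "{w, v} \<in> E"
      by (auto simp: adj_def)
    then have "w \<in> V" using E by blast
    then have "(g u, g w) \<in> adj ((`) g ` E) ^^ n" "(g w, g v) \<in> adj ((`) g ` E)"
      using w e Suc.IH by (simp_all add: adj_def)
    then show "(g u, g v) \<in> adj ((`) g ` E) ^^ Suc n" by (rule relpow_Suc_I)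
  qed
qed

lemma adj_image_rtrancl:
  assumes "inj_on g V" "\<And>e. e \<in> E \<Longrightarrow> e \<subseteq> V" "u \<in> V" "v \<in> V"
  shows "(g u, g v) \<in> (adj ((`) g ` E))\<^sup>* \<longleftrightarrow> (u, v) \<in> (adj E)\<^sup>*"
  using adj_image_relpow[OF assms] by (simp add: rtrancl_is_UN_relpow)

text \<open>The two events differ pathwise, only their probabilities agree. Every injective reading
  of the labels has the percolation law, and the events coincide if an edge of the image reads the
  label of its preimage.\<close>

lemma tau_image:
  fixes g :: "'v \<Rightarrow> 'v"
  assumes p: "0 \<le> p" "p \<le> 1" and V: "countable V" and g: "inj_on g V"
    and E: "\<And>e. e \<in> E \<Longrightarrow> e \<subseteq> V" and uv: "u \<in> V" "v \<in> V"
  shows "tau ((`) g ` E) p (g u) (g v) = tau E p u v"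
proof -
  have inj: "inj_on ((`) g) E"
    using E inj_on_image_eq_iff[OF g] by (auto intro!: inj_onI)
  define f where "f = the_inv_into E ((`) g)"
  have f: "inj_on f ((`) g ` E)" unfolding f_def by (rule inj_on_the_inv_into[OF inj])
  have V': "countable (g ` V)" using V by simp
  have E': "e \<subseteq> g ` V" if "e \<in> (`) g ` E" for e using that E by auto
  have "tau ((`) g ` E) p (g u) (g v) = two_point (g ` V, (`) g ` E) p (g u) (g v)"
    using two_point_eq_tau[OF p V', of "(g ` V, (`) g ` E)"] E' by simp
  also have "\<dots> = measure labels {x. (g u, g v) \<in> (adj {e \<in> (`) g ` E. x (f e) \<le> p})\<^sup>*}"
    using two_point_eq_labels[OF p _ V', of f "(g ` V, (`) g ` E)"] f E' by simp
  also have "(\<lambda>x. {e \<in> (`) g ` E. x (f e) \<le> p}) = (\<lambda>x. (`) g ` {e \<in> E. x e \<le> p})"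
    using inj by (auto simp: f_def the_inv_into_f_f)
  also have "measure labels {x. (g u, g v) \<in> (adj ((`) g ` {e \<in> E. x e \<le> p}))\<^sup>*} = tau E p u v"
  proof -
    have "(g u, g v) \<in> (adj ((`) g ` {e \<in> E. x e \<le> p}))\<^sup>* \<longleftrightarrow> (u, v) \<in> (adj {e \<in> E. x e \<le> p})\<^sup>*"
      for x :: "'v set \<Rightarrow> real" by (rule adj_image_rtrancl[OF g _ uv]) (simp add: E)
    then show ?thesis by (simp add: tau_def)
  qed
  finally show ?thesis .
qed

text \<open>The connection event is measurable jointly in the parameter and the labels, and
  \<open>tau\<close> is the probability of its sections.\<close>

lemma tau_measurable:
  assumes V: "countable V" and sub: "\<And>y e. y \<in> space M \<Longrightarrow> e \<in> E y \<Longrightarrow> e \<subseteq> V"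
    and meas: "\<And>w v. {y \<in> space M. {w, v} \<in> E y} \<in> sets M"
  shows "(\<lambda>y. tau (E y) p u v) \<in> borel_measurable M"
proof -
  let ?N = "M \<Otimes>\<^sub>M labels"
  let ?S = "{z \<in> space ?N. (u, v) \<in> (adj {e \<in> E (fst z). snd z e \<le> p})\<^sup>*}"
  have "{z \<in> space ?N. {w, v} \<in> {e \<in> E (fst z). snd z e \<le> p}} \<in> sets ?N" for w v
  proof -
    have "{x \<in> space labels. x {w, v} \<le> p} \<in> sets labels" by measurable
    then have "{y \<in> space M. {w, v} \<in> E y} \<times> {x \<in> space labels. x {w, v} \<le> p} \<in> sets ?N"
      using meas by auto
    also have "{y \<in> space M. {w, v} \<in> E y} \<times> {x \<in> space labels. x {w, v} \<le> p}
        = {z \<in> space ?N. {w, v} \<in> {e \<in> E (fst z). snd z e \<le> p}}"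
      by (auto simp: space_pair_measure)
    finally show ?thesis .
  qed
  then have S: "?S \<in> sets ?N"
  proof (rule rtrancl_adj_measurable[OF V, rotated])
    fix z e assume "z \<in> space ?N" "e \<in> {e \<in> E (fst z). snd z e \<le> p}"
    then show "e \<subseteq> V" using sub[of "fst z" e] by (simp add: space_pair_measure mem_Times_iff)
  qed
  have "(\<lambda>y. measure labels (Pair y -` ?S)) \<in> borel_measurable M"
    using labels.measurable_emeasure_Pair[OF S] unfolding measure_def by simp
  moreover have "measure labels (Pair y -` ?S) = tau (E y) p u v" if "y \<in> space M" for y
    using that by (auto simp: tau_def space_pair_measure intro!: arg_cong[where f = "measure labels"])
  ultimately show ?thesis by (subst measurable_cong[symmetric]) auto
qed

lemma measure_labels_all_le:
  assumes "finite F" "0 \<le> p" "p \<le> 1"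
  shows "measure labels {x. \<forall>e\<in>F. x e \<le> p} = p ^ card F"
  using measure_labels_box[of F "\<lambda>_. {..p}"] assms by (simp add: measure_uniform01)

lemma labels_all_le_sets [measurable]: "finite F \<Longrightarrow> {x. \<forall>e\<in>F. x e \<le> p} \<in> sets labels"
proof -
  assume "finite F"
  then have "{x \<in> space labels. \<forall>e\<in>F. x e \<le> p} \<in> sets labels" by measurable
  then show ?thesis by simp
qed

lemma tau_le_power:
  assumes "finite F" "0 \<le> p" "p \<le> 1"
    and "\<And>O'. O' \<subseteq> E \<Longrightarrow> (u, v) \<in> (adj O')\<^sup>* \<Longrightarrow> F \<subseteq> O'"
  shows "tau E p u v \<le> p ^ card F"
proof -
  have "{x. (u, v) \<in> (adj {e \<in> E. x e \<le> p})\<^sup>*} \<subseteq> {x. \<forall>e\<in>F. x e \<le> p}"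
    using assms(4)[of "{e \<in> E. _ e \<le> p}"] by blast
  then show ?thesis
    unfolding tau_def measure_labels_all_le[OF assms(1-3), symmetric]
    by (intro labels.finite_measure_mono labels_all_le_sets assms)
qed

lemma tau_ge_power:
  assumes V: "countable V" "\<And>e. e \<in> E \<Longrightarrow> e \<subseteq> V"
    and F: "finite F" "F \<subseteq> E" "(u, v) \<in> (adj F)\<^sup>*" and p: "0 \<le> p" "p \<le> 1"
  shows "p ^ card F \<le> tau E p u v"
  unfolding tau_def measure_labels_all_le[OF F(1) p, symmetric]
proof (rule labels.finite_measure_mono[OF _ connected_event[OF V]])
  show "{x. \<forall>e\<in>F. x e \<le> p} \<subseteq> {x. (u, v) \<in> (adj {e \<in> E. x e \<le> p})\<^sup>*}"
    using F by (auto elim!: adj_mono[rotated])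
qed

lemma finite_edges_of_path:
  assumes "(u, v) \<in> (adj E)\<^sup>*"
  shows "\<exists>F. finite F \<and> F \<subseteq> E \<and> (u, v) \<in> (adj F)\<^sup>*"
  using assms
proof induction
  case (step y z)
  then obtain F where F: "finite F" "F \<subseteq> E" "(u, y) \<in> (adj F)\<^sup>*" by auto
  have "(u, y) \<in> (adj (insert {y, z} F))\<^sup>*" by (rule adj_mono[OF subset_insertI F(3)])
  moreover have "(y, z) \<in> adj (insert {y, z} F)" by (simp add: adj_def)
  ultimately have "(u, z) \<in> (adj (insert {y, z} F))\<^sup>*" by (rule rtrancl_into_rtrancl)
  moreover have "{y, z} \<in> E" using step(2) by (simp add: adj_def)
  ultimately show ?case using F(1,2) by (intro exI[of _ "insert {y, z} F"]) simp
qed auto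

section \<open>The connectivity threshold\<close>

lemma graph_dist_gt: "graph_dist H u v > enat r \<longleftrightarrow> (\<forall>n\<le>r. (u, v) \<notin> adj (snd H) ^^ n)"
proof
  assume a: "graph_dist H u v > enat r"
  show "\<forall>n\<le>r. (u, v) \<notin> adj (snd H) ^^ n"
  proof (intro allI impI notI)
    fix n assume n: "n \<le> r" "(u, v) \<in> adj (snd H) ^^ n"
    then have "graph_dist H u v \<le> enat n" unfolding graph_dist_def by (intro INF_lower) simp
    also have "\<dots> \<le> enat r" using n by simp
    finally show False using a by simp
  qed
next
  assume a: "\<forall>n\<le>r. (u, v) \<notin> adj (snd H) ^^ n"
  have "enat (Suc r) \<le> graph_dist H u v"
    unfolding graph_dist_def using a by (intro INF_greatest) (auto simp: not_less_eq_eq[symmetric])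
  then show "graph_dist H u v > enat r" by (meson enat_ord_simps(2) lessI less_le_trans)
qed

text \<open>The condition on p inside \<open>p_conn\<close>, with the limit in
  \<open>ennreal\<close> unfolded and distance greater than \<open>r\<close> read as absence of
  walks of length at most \<open>r\<close>.\<close>

definition decays :: "'v graph \<Rightarrow> real \<Rightarrow> bool" where
  "decays H p \<longleftrightarrow> (\<forall>\<epsilon>>0. \<exists>r::nat. \<forall>u\<in>fst H. \<forall>v\<in>fst H.
     (\<forall>n\<le>r. (u, v) \<notin> adj (snd H) ^^ n) \<longrightarrow> tau (snd H) p u v \<le> \<epsilon>)"

lemma decays_iff:
  assumes p: "0 \<le> p" "p \<le> 1" and V: "countable V" "\<And>e. e \<in> snd H \<Longrightarrow> e \<subseteq> V"
  shows "(\<lambda>r::nat. SUP (u, v)\<in>{(u, v). u \<in> fst H \<and> v \<in> fst H \<and> graph_dist H u v > enat r}.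
        ennreal (two_point H p u v)) \<longlonglongrightarrow> 0 \<longleftrightarrow> decays H p" (is "?s \<longlonglongrightarrow> 0 \<longleftrightarrow> _")
proof
  assume lim: "?s \<longlonglongrightarrow> 0"
  show "decays H p"
    unfolding decays_def
  proof (intro allI impI)
    fix e :: real assume e: "e > 0"
    then have "\<forall>\<^sub>F r in sequentially. ?s r < ennreal e"
      using order_tendstoD(2)[OF lim, of "ennreal e"] by simp
    then obtain r where r: "?s r < ennreal e" by (auto simp: eventually_sequentially)
    have "tau (snd H) p u v \<le> e"
      if uv: "u \<in> fst H" "v \<in> fst H" "\<forall>n\<le>r. (u, v) \<notin> adj (snd H) ^^ n" for u v
    proof -
      have "ennreal (two_point H p u v) \<le> ?s r"
        using uv graph_dist_gt[of r H u v] by (intro SUP_upper2[of "(u, v)"]) auto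
      then have "ennreal (two_point H p u v) \<le> ennreal e" using r by simp
      then show ?thesis using e two_point_eq_tau[OF p V] by (simp add: ennreal_le_iff)
    qed
    then show "\<exists>r::nat. \<forall>u\<in>fst H. \<forall>v\<in>fst H.
       (\<forall>n\<le>r. (u, v) \<notin> adj (snd H) ^^ n) \<longrightarrow> tau (snd H) p u v \<le> e" by blast
  qed
next
  assume d: "decays H p"
  show "?s \<longlonglongrightarrow> 0"
  proof (rule order_tendstoI)
    fix a :: ennreal assume "a > 0"
    \<comment> \<open>The bound \<open>a\<close> may be infinite; anything strictly below it is a
      real number.\<close>
    then obtain b where b: "0 < b" "b < a" using dense by blast
    obtain e where e: "e > 0" "ennreal e < a"
      using b by (cases b) auto
    obtain r :: nat where r: "\<And>u v. u \<in> fst H \<Longrightarrow> v \<in> fst H \<Longrightarrow>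
        (\<forall>n\<le>r. (u, v) \<notin> adj (snd H) ^^ n) \<Longrightarrow> tau (snd H) p u v \<le> e"
      using d e unfolding decays_def by meson
    have "?s k < a" if "k \<ge> r" for k
    proof -
      have "?s k \<le> ennreal e"
      proof (intro SUP_least, clarify)
        fix u v assume uv: "u \<in> fst H" "v \<in> fst H" "enat k < graph_dist H u v"
        then have "\<forall>n\<le>r. (u, v) \<notin> adj (snd H) ^^ n" using that by (auto simp: graph_dist_gt)
        then show "ennreal (two_point H p u v) \<le> ennreal e"
          using r uv two_point_eq_tau[OF p V] e by (simp add: ennreal_le_iff)
      qed
      then show ?thesis using e by simp
    qed
    then show "\<forall>\<^sub>F r in sequentially. ?s r < a" by (auto simp: eventually_sequentially)
  qed auto
qed

lemma decays_mono:
  assumes "decays H q" "p \<le> q" and V: "countable V" "\<And>e. e \<in> snd H \<Longrightarrow> e \<subseteq> V"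
  shows "decays H p"
  using assms(1) tau_mono[OF V assms(2)] unfolding decays_def by (meson order_trans)

text \<open>At \<open>p = 0\<close> an open edge has a label at most 0, which is a null event, and a
  path between distinct vertices starts with one of countably many edges at
  \<open>u\<close>.\<close>

lemma decays_0:
  fixes H :: "'v graph"
  assumes "countable V" "\<And>e. e \<in> snd H \<Longrightarrow> e \<subseteq> V" 
  shows "decays H 0"
  unfolding decays_def
proof (intro allI impI exI ballI)
  fix e :: real and u v assume e: "e > 0" and "\<forall>n\<le>(0::nat). (u, v) \<notin> adj (snd H) ^^ n"
  then have uv: "u \<noteq> v" by auto
  let ?A = "\<lambda>w. {x :: 'v set \<Rightarrow> real. \<forall>e\<in>{{u, w}}. x e \<le> (0::real)}"
  have "{x. (u, v) \<in> (adj {e \<in> snd H. x e \<le> 0})\<^sup>*} \<subseteq> (\<Union>w\<in>V. ?A w)"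
  proof clarify
    fix x :: "'v set \<Rightarrow> real" assume "(u, v) \<in> (adj {e \<in> snd H. x e \<le> 0})\<^sup>*"
    then obtain w where "(u, w) \<in> adj {e \<in> snd H. x e \<le> 0}"
      using uv by (metis converse_rtranclE)
    then show "x \<in> (\<Union>w\<in>V. ?A w)" using assms(2) by (auto simp: adj_def)
  qed
  moreover have "(\<Union>w\<in>V. ?A w) \<in> null_sets labels"
  proof (rule null_sets_UN'[OF assms(1)])
    fix w
    show "?A w \<in> null_sets labels"
      using measure_labels_all_le[of "{{u, w}}" 0] labels_all_le_sets[of "{{u, w}}" 0]
      by (auto simp: null_sets_def labels.emeasure_eq_measure)
  qed
  ultimately have "{x. (u, v) \<in> (adj {e \<in> snd H. x e \<le> 0})\<^sup>*} \<in> null_sets labels"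
    using connected_event[OF assms] null_sets_subset by blast
  then have "tau (snd H) 0 u v = 0"
    unfolding tau_def by (auto simp: measure_def null_sets_def)
  then show "tau (snd H) 0 u v \<le> e" using e by simp
qed

text \<open>The admissible parameters form a down-set in the unit interval that contains 0. A
  supremum of 1 need not be attained, hence the condition for \<open>p < 1\<close> only.\<close>

lemma p_conn_eq_1_iff:
  assumes V: "countable V" "\<And>e. e \<in> snd H \<Longrightarrow> e \<subseteq> V"
  shows "p_conn H = 1 \<longleftrightarrow> (\<forall>p. 0 \<le> p \<and> p < 1 \<longrightarrow> decays H p)"
proof -
  define D where "D = {p \<in> {0..1}. decays H p}"
  have D: "p_conn H = Sup D"
    unfolding p_conn_def D_def
    using decays_iff[where H = H, OF _ _ V] by (intro arg_cong[where f = Sup] Collect_cong conj_cong refl) simp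
  have "0 \<in> D" using decays_0[where H = H, OF V] by (simp add: D_def)
  then have ne: "D \<noteq> {}" by blast
  have bdd: "bdd_above D" by (rule bdd_aboveI[of _ 1]) (simp add: D_def)
  have le: "Sup D \<le> 1" using ne by (intro cSup_least) (auto simp: D_def)
  show ?thesis
  proof
    assume s: "p_conn H = 1"
    show "\<forall>p. 0 \<le> p \<and> p < 1 \<longrightarrow> decays H p"
    proof (intro allI impI)
      fix p :: real assume "0 \<le> p \<and> p < 1"
      then obtain q where "q \<in> D" "p < q" using s less_cSup_iff[OF ne bdd] D by auto
      then show "decays H p" using decays_mono[where H = H, OF _ _ V, of q p] by (auto simp: D_def)
    qed
  next
    assume d: "\<forall>p. 0 \<le> p \<and> p < 1 \<longrightarrow> decays H p"
    have "1 \<le> Sup D"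
    proof (rule dense_le_bounded[of 0 1])
      fix p :: real assume "0 < p" "p < 1"
      then show "p \<le> Sup D" using d by (intro cSup_upper bdd) (auto simp: D_def)
    qed simp
    then show "p_conn H = 1" using D le by simp
  qed
qed

section \<open>Hanging trees on a subgraph\<close>

lemma relpow_adj_sym: "(u, v) \<in> adj E ^^ n \<Longrightarrow> (v, u) \<in> adj E ^^ n"
proof (induction n arbitrary: v)
  case (Suc n)
  then obtain w where w: "(u, w) \<in> adj E ^^ n" "(w, v) \<in> adj E" by auto
  then have "(v, w) \<in> adj E" using sym_adj by (metis symD)
  then show ?case using Suc.IH[OF w(1)] by (rule relpow_Suc_I2)
qed auto

lemma relpow_adj_mono: "E \<subseteq> F \<Longrightarrow> (u, v) \<in> adj E ^^ n \<Longrightarrow> (u, v) \<in> adj F ^^ n"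
proof (induction n arbitrary: v)
  case (Suc n)
  then obtain w where w: "(u, w) \<in> adj E ^^ n" "(w, v) \<in> adj E" by auto
  then have "(w, v) \<in> adj F" using Suc.prems(1) by (auto simp: adj_def)
  then show ?case using Suc.IH[OF Suc.prems(1) w(1)] by (rule relpow_Suc_I[rotated])
qed auto

lemma relpow_trans: "(u, v) \<in> r ^^ m \<Longrightarrow> (v, w) \<in> r ^^ n \<Longrightarrow> (u, w) \<in> r ^^ (m + n)"
  by (auto simp: relpow_add)

text \<open>The parents of the vertices of \<open>V\<close> are set to themselves, so that the iterates of \<open>par\<close> stop at
  the root.\<close>

locale hanging_forest =
  fixes V W :: "'v set" and E :: "'v set set" and par :: "'v \<Rightarrow> 'v" and h :: "'v \<Rightarrow> nat"
  assumes V_sub: "V \<subseteq> W" and countable_W: "countable W"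
    and E_sub: "e \<in> E \<Longrightarrow> e \<subseteq> V"
    and par_V: "g \<in> V \<Longrightarrow> par g = g"
    and par_W: "g \<in> W \<Longrightarrow> par g \<in> W"
    and par_less: "g \<in> W \<Longrightarrow> g \<notin> V \<Longrightarrow> h (par g) < h g"
begin

definition full :: "'v set set" where
  "full = E \<union> {{g, par g} |g. g \<in> W - V}"

lemma iter_W: "g \<in> W \<Longrightarrow> (par ^^ i) g \<in> W"
  by (induction i) (auto simp: par_W)

lemma iter_V: "g \<in> V \<Longrightarrow> (par ^^ i) g = g"
  by (induction i) (auto simp: par_V)

lemma iter_add: "(par ^^ (i + j)) g = (par ^^ j) ((par ^^ i) g)"
  by (simp add: add.commute[of i j] funpow_add)

lemma iter_stable: "(par ^^ i) g \<in> V \<Longrightarrow> i \<le> j \<Longrightarrow> (par ^^ j) g = (par ^^ i) g"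
  using iter_add[of i "j - i" g] by (simp add: iter_V)

lemma height_iter: "g \<in> W \<Longrightarrow> (par ^^ i) g \<notin> V \<Longrightarrow> h ((par ^^ i) g) + i \<le> h g"
proof (induction i)
  case (Suc i)
  have nV: "(par ^^ i) g \<notin> V" using Suc.prems(2) par_V by auto
  show ?case using Suc.IH[OF Suc.prems(1) nV] par_less[OF iter_W[OF Suc.prems(1)] nV] by simp
qed simp

text \<open>Each step outside \<open>V\<close> lowers \<open>h\<close>, so \<open>h g\<close> steps
  are enough to reach \<open>V\<close>.\<close>

definition root :: "'v \<Rightarrow> 'v" where "root g = (par ^^ h g) g"

lemma root_V: assumes "g \<in> W" shows "root g \<in> V"
proof (rule ccontr)
  assume n: "root g \<notin> V"
  have "h (root g) = 0" using height_iter[OF assms, of "h g"] n by (simp add: root_def)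
  then show False using par_less[of "root g"] n iter_W[OF assms] by (simp add: root_def)
qed

lemma root_eq: "g \<in> W \<Longrightarrow> (par ^^ i) g \<in> V \<Longrightarrow> (par ^^ i) g = root g"
  using iter_stable[of i g "max i (h g)"] iter_stable[of "h g" g "max i (h g)"] root_V[of g]
  by (simp add: root_def)

lemma root_par: assumes "g \<in> W" shows "root (par g) = root g"
proof -
  have "(par ^^ Suc (h (par g))) g = root (par g)" by (simp add: root_def funpow_swap1)
  then show ?thesis using root_eq[OF assms, of "Suc (h (par g))"] root_V[OF par_W[OF assms]] by simp
qed

lemma root_of_V: "g \<in> V \<Longrightarrow> root g = g"
  by (simp add: root_def iter_V)

text \<open>The length is only bounded by \<open>i\<close>, since the iteration may already rest in
  \<open>V\<close>.\<close>

lemma path_up: "g \<in> W \<Longrightarrow> \<exists>n\<le>i. (g, (par ^^ i) g) \<in> adj full ^^ n"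
proof (induction i)
  case (Suc i)
  then obtain n where n: "n \<le> i" "(g, (par ^^ i) g) \<in> adj full ^^ n" by auto
  show ?case
  proof (cases "(par ^^ i) g \<in> V")
    case True
    then show ?thesis using n by (intro exI[of _ n]) (auto simp: par_V)
  next
    case False
    then have "((par ^^ i) g, (par ^^ Suc i) g) \<in> adj full"
      using iter_W[OF Suc.prems] by (auto simp: adj_def full_def)
    then show ?thesis using n relpow_Suc_I[OF n(2)] by (intro exI[of _ "Suc n"]) auto
  qed
qed auto

definition desc :: "'v \<Rightarrow> 'v set" where "desc x = {y \<in> W. \<exists>i. (par ^^ i) y = x}"

text \<open>The edge to the parent is the only one leaving the set of descendants.\<close>

lemma crossing_edge:
  assumes path: "(u, v) \<in> (adj F)\<^sup>*" and F: "F \<subseteq> full"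
    and u: "u \<in> desc x" and v: "v \<notin> desc x" and x: "x \<notin> V"
  shows "{x, par x} \<in> F"
  using path v
proof induction
  case base
  then show ?case using u by simp
next
  case (step y w)
  show ?case
  proof (cases "y \<in> desc x")
    case False
    then show ?thesis using step by simp
  next
    case True
    then obtain i where y: "y \<in> W" "(par ^^ i) y = x" by (auto simp: desc_def)
    have e: "{y, w} \<in> F" using step by (simp add: adj_def)
    have yV: "y \<notin> V" using y x iter_V[of y i] by auto
    then have "{y, w} \<notin> E" using E_sub by blast
    then obtain g where g: "g \<in> W" "g \<notin> V" "{y, w} = {g, par g}"
      using e F by (auto simp: full_def)
    then consider "y = g" "w = par g" | "y = par g" "w = g" by (auto simp: doubleton_eq_iff)
    then show ?thesis
    proof cases
      case 1
      show ?thesis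
      proof (cases i)
        case 0
        then show ?thesis using e y 1 by simp
      next
        case (Suc k)
        then have "(par ^^ k) w = x" using y 1 by (simp add: funpow_swap1)
        then show ?thesis using step.prems g par_W 1 by (auto simp: desc_def)
      qed
    next
      case 2
      then have "(par ^^ Suc i) w = x" using y by (simp add: funpow_swap1)
      then show ?thesis using step.prems g 2 unfolding desc_def by blast
    qed
  qed
qed

text \<open>Collapsing every tree to its root contracts the hanging edges to points and fixes the
  edges of \<open>E\<close>.\<close>

lemma roots_connected:
  assumes "(u, v) \<in> (adj F)\<^sup>*" and F: "F \<subseteq> full"
  shows "(root u, root v) \<in> (adj (F \<inter> E))\<^sup>*"
  using assms(1)
proof induction
  case (step y w)
  have e: "{y, w} \<in> F" using step by (simp add: adj_def)
  then consider "{y, w} \<in> E" | g where "g \<in> W" "{y, w} = {g, par g}"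
    using F by (auto simp: full_def)
  then have "(root y, root w) \<in> (adj (F \<inter> E))\<^sup>*"
  proof cases
    case 1
    then have "y \<in> V" "w \<in> V" using E_sub by auto
    then show ?thesis using 1 e by (auto simp: root_of_V adj_def)
  next
    case 2
    then have "root y = root w" by (auto simp: doubleton_eq_iff root_par)
    then show ?thesis by simp
  qed
  then show ?case using step by (meson rtrancl_trans)
qed simp

lemma full_connected:
  assumes "graph_connected (V, E)"
  shows "graph_connected (W, full)"
  unfolding graph_connected_def
proof (intro ballI)
  have up: "(g, root g) \<in> (adj full)\<^sup>*" if "g \<in> W" for g
    using path_up[OF that, of "h g"] by (auto simp: root_def intro: relpow_imp_rtrancl)
  fix u v assume "u \<in> fst (W, full)" "v \<in> fst (W, full)"
  then have uv: "u \<in> W" "v \<in> W" by auto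
  have "(root u, root v) \<in> (adj full)\<^sup>*"
    using assms root_V uv adj_mono[of E full] by (auto simp: graph_connected_def full_def)
  then show "(u, v) \<in> (adj (snd (W, full)))\<^sup>*"
    using up[OF uv(1)] up[OF uv(2)] rtrancl_adj_sym[of v "root v"] by (auto intro: rtrancl_trans)
qed

lemma card_path_edges:
  assumes u: "u \<in> W" and nV: "\<forall>i<n. (par ^^ i) u \<notin> V"
  shows "card ((\<lambda>i. {(par ^^ i) u, par ((par ^^ i) u)}) ` {..<n}) = n"
proof -
  let ?x = "\<lambda>i. (par ^^ i) u"
  have ne: "{?x i, par (?x i)} \<noteq> {?x j, par (?x j)}" if ij: "i < j" "j < n" for i j
  proof
    assume "{?x i, par (?x i)} = {?x j, par (?x j)}"
    \<comment> \<open>Impossible, as both \<open>?x j\<close> and its parent are strictly lower than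
      \<open>?x i\<close>.\<close>
    then have "?x i = ?x j \<or> ?x i = par (?x j)" by auto
    moreover have "?x j = (par ^^ (j - i)) (?x i)" using iter_add[of i "j - i" u] ij by simp
    then have "h (?x j) + (j - i) \<le> h (?x i)"
      using height_iter[OF iter_W[OF u], of "j - i" i] nV ij by auto
    moreover have "h (par (?x j)) < h (?x j)" using par_less[OF iter_W[OF u]] nV ij by blast
    ultimately show False using ij by auto
  qed
  have "inj_on (\<lambda>i. {?x i, par (?x i)}) {..<n}"
    by (intro linorder_inj_onI) (use ne in auto)
  then show ?thesis by (simp add: card_image)
qed

text \<open>By \<open>crossing_edge\<close>, each of the first \<open>n\<close> parent edges above
  \<open>u\<close> must be open on any connection to \<open>v\<close>; these edges are distinct and
  independent.\<close>

lemma tau_full_le_power: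
  assumes p: "0 \<le> p" "p \<le> 1" and u: "u \<in> W"
    and far: "\<forall>i<n. (par ^^ i) u \<notin> V \<and> v \<notin> desc ((par ^^ i) u)"
  shows "tau full p u v \<le> p ^ n"
proof -
  let ?F = "(\<lambda>i. {(par ^^ i) u, par ((par ^^ i) u)}) ` {..<n}"
  have "tau full p u v \<le> p ^ card ?F"
  proof (rule tau_le_power[OF _ p])
    fix F assume F: "F \<subseteq> full" "(u, v) \<in> (adj F)\<^sup>*"
    have "{(par ^^ i) u, par ((par ^^ i) u)} \<in> F" if "i < n" for i
      using far that u by (intro crossing_edge[OF F(2,1)]) (auto simp: desc_def)
    then show "?F \<subseteq> F" by auto
  qed simp
  then show ?thesis using card_path_edges[OF u] far by simp
qed

text \<open>The situation left over when neither endpoint is protected by \<open>n\<close> parent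
  edges: the branches then merge within \<open>n\<close> steps on both sides, or both reach
  \<open>V\<close> by then.\<close>

lemma branches_meet:
  assumes uv: "u \<in> W" "v \<in> W" and ij: "i < n" "j < n"
    and i: "(par ^^ i) u \<in> V \<or> v \<in> desc ((par ^^ i) u)"
    and j: "(par ^^ j) v \<in> V \<or> u \<in> desc ((par ^^ j) v)"
  shows "(\<exists>k<n. \<exists>l<n. (par ^^ k) u = (par ^^ l) v) \<or> ((par ^^ i) u \<in> V \<and> (par ^^ j) v \<in> V)"
proof (cases "(par ^^ i) u \<in> V")
  case True
  show ?thesis
  proof (cases "(par ^^ j) v \<in> V")
    case False
    then obtain l where l: "(par ^^ l) u = (par ^^ j) v" using j by (auto simp: desc_def)
    have "l < i" using iter_stable[OF True, of l] l False True by (metis not_le)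
    then show ?thesis using l ij by (meson less_trans)
  qed (use True in simp)
next
  case False
  then obtain k where k: "(par ^^ k) v = (par ^^ i) u" using i by (auto simp: desc_def)
  show ?thesis
  proof (cases "k < n")
    case True
    then show ?thesis using k ij by metis
  next
    case kn: False
    have y: "(par ^^ j) v \<notin> V" using iter_stable[of j v k] k kn ij False by auto
    then obtain l where l: "(par ^^ l) u = (par ^^ j) v" using j by (auto simp: desc_def)
    show ?thesis
    proof (cases "l < n")
      case True
      then show ?thesis using l ij by metis
    next
      case ln: False
      have "(par ^^ j) v = (par ^^ (l - i)) ((par ^^ i) u)"
        using iter_add[of i "l - i" u] l ij ln by simp
      then have "h ((par ^^ j) v) + (l - i) \<le> h ((par ^^ i) u)"
        using height_iter[OF iter_W[OF uv(1)], of "l - i" i] y by simp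
      moreover have "(par ^^ i) u = (par ^^ (k - j)) ((par ^^ j) v)"
        using iter_add[of j "k - j" v] k ij kn by simp
      then have "h ((par ^^ i) u) + (k - j) \<le> h ((par ^^ j) v)"
        using height_iter[OF iter_W[OF uv(2)], of "k - j" j] False by simp
      \<comment> \<open>Each of the two vertices would be an ancestor of the other, and
        \<open>l > i\<close> makes one of them strictly so, against the heights.\<close>
      ultimately show ?thesis using ij ln by simp
    qed
  qed
qed

lemma tau_full_le_roots:
  "tau full p u v \<le> tau E p (root u) (root v)"
  unfolding tau_def
proof (rule labels.finite_measure_mono)
  show "{x. (root u, root v) \<in> (adj {e \<in> E. x e \<le> p})\<^sup>*} \<in> sets labels"
    using countable_W E_sub V_sub by (intro connected_event[of W]) auto
  show "{x. (u, v) \<in> (adj {e \<in> full. x e \<le> p})\<^sup>*} \<subseteq> {x. (root u, root v) \<in> (adj {e \<in> E. x e \<le> p})\<^sup>*}"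
  proof clarify
    fix x :: "'v set \<Rightarrow> real" assume "(u, v) \<in> (adj {e \<in> full. x e \<le> p})\<^sup>*"
    from roots_connected[OF this]
    have "(root u, root v) \<in> (adj ({e \<in> full. x e \<le> p} \<inter> E))\<^sup>*" by blast
    then show "(root u, root v) \<in> (adj {e \<in> E. x e \<le> p})\<^sup>*" by (rule adj_mono[rotated]) blast
  qed
qed

lemma full_decays:
  assumes p: "0 \<le> p" "p < 1" and d: "decays (V, E) p"
  shows "decays (W, full) p"
  unfolding decays_def
proof (intro allI impI)
  fix e :: real assume e: "e > 0"
  obtain r :: nat where r: "\<And>u v. u \<in> V \<Longrightarrow> v \<in> V \<Longrightarrow>
      (\<forall>n\<le>r. (u, v) \<notin> adj E ^^ n) \<Longrightarrow> tau E p u v \<le> e"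
    using d e unfolding decays_def by force
  have "\<forall>\<^sub>F n in sequentially. p ^ n < e"
    using LIMSEQ_realpow_zero[OF p] e by (intro order_tendstoD)
  then obtain k where k: "p ^ k < e" by (auto simp: eventually_sequentially)
  \<comment> \<open>The value \<open>k\<close> makes the tree estimate small, and \<open>r\<close>
    is the range beyond which the estimate in \<open>(V, E)\<close> holds.\<close>
  define n where "n = max r k"
  have pn: "p ^ n \<le> e"
    using k power_decreasing[of k n p] p by (simp add: n_def)
  have "tau full p u v \<le> e"
    \<comment> \<open>Three pieces of length at most \<open>n\<close>: up from \<open>u\<close>,
      across \<open>(V, E)\<close> between the two roots, and down to \<open>v\<close>.\<close>
    if uv: "u \<in> W" "v \<in> W" and far: "\<forall>m\<le>3 * n. (u, v) \<notin> adj full ^^ m" for u v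
  proof -
    consider "\<forall>i<n. (par ^^ i) u \<notin> V \<and> v \<notin> desc ((par ^^ i) u)"
      | "\<forall>j<n. (par ^^ j) v \<notin> V \<and> u \<notin> desc ((par ^^ j) v)"
      | i j where "i < n" "j < n" "(par ^^ i) u \<in> V \<or> v \<in> desc ((par ^^ i) u)"
          "(par ^^ j) v \<in> V \<or> u \<in> desc ((par ^^ j) v)"
      by blast
    then show ?thesis
    proof cases
      case 1
      then show ?thesis using tau_full_le_power[of p u n v] p uv pn by simp
    next
      case 2
      then show ?thesis using tau_full_le_power[of p v n u] p uv pn tau_sym[of full p u v] by simp
    next
      case (3 i j)
      have up: "\<exists>m\<le>n. (g, (par ^^ k) g) \<in> adj full ^^ m" if "g \<in> W" "k < n" for g k
        using path_up[OF that(1), of k] that(2) by (meson le_trans less_imp_le)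
      from branches_meet[OF uv 3] show ?thesis
      proof
        assume "\<exists>k<n. \<exists>l<n. (par ^^ k) u = (par ^^ l) v"
        then obtain k l where kl: "k < n" "l < n" "(par ^^ k) u = (par ^^ l) v" by blast
        obtain a b where "a \<le> n" "(u, (par ^^ k) u) \<in> adj full ^^ a"
          "b \<le> n" "(v, (par ^^ k) u) \<in> adj full ^^ b"
          using up[OF uv(1) kl(1)] up[OF uv(2) kl(2)] kl(3) by auto
        then have "(u, v) \<in> adj full ^^ (a + b)" "a + b \<le> 3 * n"
          by (auto intro: relpow_trans relpow_adj_sym)
        then show ?thesis using far by blast
      next
        assume V: "(par ^^ i) u \<in> V \<and> (par ^^ j) v \<in> V"
        obtain a b where ab: "a \<le> n" "(u, (par ^^ i) u) \<in> adj full ^^ a"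
          "b \<le> n" "(v, (par ^^ j) v) \<in> adj full ^^ b"
          using up[OF uv(1) 3(1)] up[OF uv(2) 3(2)] by auto
        have "((par ^^ i) u, (par ^^ j) v) \<notin> adj E ^^ m" if "m \<le> r" for m
        proof
          assume "((par ^^ i) u, (par ^^ j) v) \<in> adj E ^^ m"
          then have "((par ^^ i) u, (par ^^ j) v) \<in> adj full ^^ m"
            using relpow_adj_mono[of E full] by (auto simp: full_def)
          then have "(u, v) \<in> adj full ^^ (a + m + b)"
            using ab by (meson relpow_trans relpow_adj_sym)
          moreover have "a + m + b \<le> 3 * n" using ab that by (simp add: n_def)
          ultimately show False using far by blast
        qed
        then have "tau E p ((par ^^ i) u) ((par ^^ j) v) \<le> e" using r V by blast
        then have "tau E p (root u) (root v) \<le> e" using root_eq uv V by metis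
        then show ?thesis using tau_full_le_roots[of p u v] by simp
      qed
    qed
  qed
  then show "\<exists>r::nat. \<forall>u\<in>fst (W, full). \<forall>v\<in>fst (W, full).
      (\<forall>n\<le>r. (u, v) \<notin> adj (snd (W, full)) ^^ n) \<longrightarrow> tau (snd (W, full)) p u v \<le> e"
    by (intro exI[of _ "3 * n"]) auto
qed

end

section \<open>Random subgraphs of a Cayley graph\<close>

lemma pred_transfer:
  "Measurable.pred M Q \<Longrightarrow> (\<And>x. x \<in> space M \<Longrightarrow> P x \<longleftrightarrow> Q x) \<Longrightarrow> Measurable.pred M P"
  using measurable_cong[of M P Q] by blast

lemma pred_countable_Bex:
  assumes "countable I" "\<And>i. i \<in> I \<Longrightarrow> Measurable.pred M (\<lambda>x. P x i)"
  shows "Measurable.pred M (\<lambda>x. \<exists>i\<in>I. P x i)"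
proof -
  have "(\<Union>i\<in>I. {x \<in> space M. P x i}) \<in> sets M"
    using assms by (intro sets.countable_UN') (auto simp: pred_def)
  also have "(\<Union>i\<in>I. {x \<in> space M. P x i}) = {x \<in> space M. \<exists>i\<in>I. P x i}" by auto
  finally show ?thesis by (simp add: pred_def)
qed

lemma pred_countable_Ball:
  assumes "countable I" "\<And>i. i \<in> I \<Longrightarrow> Measurable.pred M (\<lambda>x. P x i)"
  shows "Measurable.pred M (\<lambda>x. \<forall>i\<in>I. P x i)"
proof -
  have "Measurable.pred M (\<lambda>x. \<not> (\<exists>i\<in>I. \<not> P x i))"
    by (intro pred_intros_logic pred_countable_Bex assms)
  then show ?thesis by simp
qed

locale cayley = group G for G (structure) +
  fixes S :: "'a set"
  assumes S_sub: "S \<subseteq> carrier G" and finite_S: "finite S"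
    and S_inv: "s \<in> S \<Longrightarrow> inv s \<in> S"
    and gen: "generate G S = carrier G"
begin

abbreviation "K \<equiv> cayley_graph G S"
abbreviation "KS \<equiv> subgraph_space K"

lemma fst_K [simp]: "fst K = carrier G"
  by (simp add: cayley_graph_def)

lemma edge_iff: "{x, y} \<in> snd K \<longleftrightarrow> x \<in> carrier G \<and> (\<exists>s\<in>S. y = x \<otimes> s)"
proof
  assume "{x, y} \<in> snd K"
  then obtain g s where g: "g \<in> carrier G" "s \<in> S" "{x, y} = {g, g \<otimes> s}"
    by (auto simp: cayley_graph_def)
  then have s: "s \<in> carrier G" using S_sub by auto
  from g(3) consider "x = g" "y = g \<otimes> s" | "x = g \<otimes> s" "y = g" by (auto simp: doubleton_eq_iff)
  then show "x \<in> carrier G \<and> (\<exists>s\<in>S. y = x \<otimes> s)"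
  proof cases
    case 2
    then have "y = x \<otimes> inv s" using g s by (simp add: m_assoc)
    then show ?thesis using 2 g s S_inv by auto
  qed (use g in auto)
qed (auto simp: cayley_graph_def)

lemma edge_sub: "e \<in> snd K \<Longrightarrow> e \<subseteq> carrier G"
  using S_sub by (auto simp: cayley_graph_def)

lemma K_connected: "x \<in> carrier G \<Longrightarrow> y \<in> carrier G \<Longrightarrow> (x, y) \<in> (adj (snd K))\<^sup>*"
proof -
  have *: "(x, x \<otimes> h) \<in> (adj (snd K))\<^sup>*" if "h \<in> generate G S" "x \<in> carrier G" for x h
    using that
  proof (induction arbitrary: x)
    case one
    then show ?case by simp
  next
    case (incl h)
    then show ?case by (auto simp: adj_def edge_iff)
  next
    case (inv h)
    then show ?case using S_inv by (auto simp: adj_def edge_iff)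
  next
    case (eng h1 h2)
    have c: "h1 \<in> carrier G" "h2 \<in> carrier G" using eng.hyps gen by auto
    have "(x, x \<otimes> h1) \<in> (adj (snd K))\<^sup>*" using eng by auto
    moreover have "(x \<otimes> h1, x \<otimes> h1 \<otimes> h2) \<in> (adj (snd K))\<^sup>*" using eng c by auto
    ultimately show ?case using c eng.prems by (simp add: m_assoc)
  qed
  assume xy: "x \<in> carrier G" "y \<in> carrier G"
  then show ?thesis using *[of "inv x \<otimes> y" x] gen by (simp add: m_assoc[symmetric])
qed

lemma finite_ball: "finite {y. \<exists>n\<le>r. (x, y) \<in> adj (snd K) ^^ n}"
proof -
  have "finite {y. (x, y) \<in> adj (snd K) ^^ n}" for n
  proof (induction n)
    case (Suc n)
    have "{y. (x, y) \<in> adj (snd K) ^^ Suc n} \<subseteq> (\<Union>w\<in>{y. (x, y) \<in> adj (snd K) ^^ n}. (\<lambda>s. w \<otimes> s) ` S)"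
      by (auto simp: adj_def edge_iff)
    moreover have "finite (\<Union>w\<in>{y. (x, y) \<in> adj (snd K) ^^ n}. (\<lambda>s. w \<otimes> s) ` S)"
      using Suc finite_S by auto
    ultimately show ?case by (rule finite_subset)
  qed simp
  then have "finite (\<Union>n\<in>{..r}. {y. (x, y) \<in> adj (snd K) ^^ n})" by blast
  moreover have "{y. \<exists>n\<le>r. (x, y) \<in> adj (snd K) ^^ n} = (\<Union>n\<in>{..r}. {y. (x, y) \<in> adj (snd K) ^^ n})"
    by auto
  ultimately show ?thesis by simp
qed

lemma countable_carrier: "countable (carrier G)"
proof -
  have "carrier G \<subseteq> (\<Union>r. {y. \<exists>n\<le>r. (\<one>, y) \<in> adj (snd K) ^^ n})"
  proof
    fix y assume "y \<in> carrier G"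
    then obtain n where "(\<one>, y) \<in> adj (snd K) ^^ n"
      using K_connected[OF one_closed] rtrancl_imp_relpow by metis
    then show "y \<in> (\<Union>r. {y. \<exists>n\<le>r. (\<one>, y) \<in> adj (snd K) ^^ n})" by blast
  qed
  moreover have "countable (\<Union>r. {y. \<exists>n\<le>r. (\<one>, y) \<in> adj (snd K) ^^ n})"
    using countable_finite[OF finite_ball] by (intro countable_UN) auto
  ultimately show ?thesis by (rule countable_subset)
qed

section \<open>Measurable events and functions of a subgraph\<close>

lemma space_KS: "space KS = {H. is_subgraph H K}"
  by (auto simp: subgraph_space_def space_measure_of_conv)

lemma fst_sub: "H \<in> space KS \<Longrightarrow> fst H \<subseteq> carrier G"
  by (simp add: space_KS is_subgraph_def)

lemma snd_sub: "H \<in> space KS \<Longrightarrow> e \<in> snd H \<Longrightarrow> e \<in> snd K"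
  by (auto simp: space_KS is_subgraph_def)

lemma snd_sub_fst: "H \<in> space KS \<Longrightarrow> e \<in> snd H \<Longrightarrow> e \<subseteq> fst H"
  by (auto simp: space_KS is_subgraph_def)

lemma snd_sub_carrier: "H \<in> space KS \<Longrightarrow> e \<in> snd H \<Longrightarrow> e \<subseteq> carrier G"
  using fst_sub snd_sub_fst by blast

lemma sets_KS: "sets KS = sigma_sets {H. is_subgraph H K}
     ({{H. is_subgraph H K \<and> v \<in> fst H} |v. v \<in> fst K} \<union>
      {{H. is_subgraph H K \<and> e \<in> snd H} |e. e \<in> snd K})"
  unfolding subgraph_space_def by (rule sets_measure_of) auto

lemma pred_vertex [measurable]: "Measurable.pred KS (\<lambda>H. v \<in> fst H)"
proof (cases "v \<in> carrier G")
  case True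
  then have "{H. is_subgraph H K \<and> v \<in> fst H} \<in> sets KS"
    unfolding sets_KS by (intro sigma_sets.Basic) auto
  then show ?thesis by (simp add: pred_def space_KS)
next
  case False
  then have "{H \<in> space KS. v \<in> fst H} = {}" using fst_sub by blast
  then show ?thesis unfolding pred_def by (simp only: sets.empty_sets)
qed

lemma pred_edge [measurable]: "Measurable.pred KS (\<lambda>H. e \<in> snd H)"
proof (cases "e \<in> snd K")
  case True
  then have "{H. is_subgraph H K \<and> e \<in> snd H} \<in> sets KS"
    unfolding sets_KS by (intro sigma_sets.Basic) auto
  then show ?thesis by (simp add: pred_def space_KS)
next
  case False
  then have "{H \<in> space KS. e \<in> snd H} = {}" using snd_sub by blast
  then show ?thesis unfolding pred_def by (simp only: sets.empty_sets)
qed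

lemma measurable_into_KS:
  assumes "f \<in> space N \<rightarrow> space KS"
    and v: "\<And>v. v \<in> carrier G \<Longrightarrow> Measurable.pred N (\<lambda>x. v \<in> fst (f x))"
    and e: "\<And>e. e \<in> snd K \<Longrightarrow> Measurable.pred N (\<lambda>x. e \<in> snd (f x))"
  shows "f \<in> measurable N KS"
  unfolding subgraph_space_def
proof (rule measurable_measure_of)
  show "f \<in> space N \<rightarrow> {H. is_subgraph H K}" using assms(1) by (simp add: space_KS)
  fix A assume A: "A \<in> {{H. is_subgraph H K \<and> v \<in> fst H} |v. v \<in> fst K} \<union>
      {{H. is_subgraph H K \<and> e \<in> snd H} |e. e \<in> snd K}"
  have sub: "\<And>x. x \<in> space N \<Longrightarrow> is_subgraph (f x) K" using assms(1) by (auto simp: space_KS)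
  from A consider v where "v \<in> carrier G" "A = {H. is_subgraph H K \<and> v \<in> fst H}"
    | e where "e \<in> snd K" "A = {H. is_subgraph H K \<and> e \<in> snd H}" by auto
  then show "f -` A \<inter> space N \<in> sets N"
  proof cases
    case 1
    then have "f -` A \<inter> space N = {x \<in> space N. v \<in> fst (f x)}" using sub by auto
    then show ?thesis using v[OF 1(1)] by (simp add: pred_def)
  next
    case 2
    then have "f -` A \<inter> space N = {x \<in> space N. e \<in> snd (f x)}" using sub by auto
    then show ?thesis using e[OF 2(1)] by (simp add: pred_def)
  qed
qed auto

lemma pred_edge_set: "{H \<in> space KS. {w, v} \<in> snd H} \<in> sets KS"
  using pred_edge by (simp add: pred_def)

lemma pred_relpow [measurable]: "Measurable.pred KS (\<lambda>H. (u, v) \<in> adj (snd H) ^^ n)"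
  unfolding pred_def
  by (rule relpow_adj_measurable[OF countable_carrier snd_sub_carrier pred_edge_set])

lemma pred_rtrancl [measurable]: "Measurable.pred KS (\<lambda>H. (u, v) \<in> (adj (snd H))\<^sup>*)"
  unfolding pred_def
  by (rule rtrancl_adj_measurable[OF countable_carrier snd_sub_carrier pred_edge_set])

lemma measurable_tau [measurable]: "(\<lambda>H. tau (snd H) p u v) \<in> borel_measurable KS"
  by (rule tau_measurable[OF countable_carrier snd_sub_carrier pred_edge_set])

text \<open>The quantifier ranges over a random set; it is moved to the countable carrier with
  membership as a premise.\<close>

lemma pred_vertices:
  assumes "\<And>v. v \<in> carrier G \<Longrightarrow> Measurable.pred KS (\<lambda>H. P H v)"
  shows "Measurable.pred KS (\<lambda>H. \<forall>v\<in>fst H. P H v)"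
proof -
  have "Measurable.pred KS (\<lambda>H. \<forall>v\<in>carrier G. v \<in> fst H \<longrightarrow> P H v)"
    by (intro pred_countable_Ball countable_carrier pred_intros_logic pred_vertex assms)
  then show ?thesis
  proof (rule pred_transfer)
    show "(\<forall>v\<in>fst H. P H v) \<longleftrightarrow> (\<forall>v\<in>carrier G. v \<in> fst H \<longrightarrow> P H v)" if "H \<in> space KS" for H
      using fst_sub[OF that] by blast
  qed
qed

lemma pred_connected: "Measurable.pred KS graph_connected"
  unfolding graph_connected_def by (intro pred_vertices pred_rtrancl)

text \<open>Restricting the tolerance to reciprocals of positive integers makes all quantifiers
  countable.\<close>

lemma pred_decays: "Measurable.pred KS (\<lambda>H. decays H p)"
proof -
  have eq: "decays H p \<longleftrightarrow> (\<forall>k::nat. \<exists>r::nat. \<forall>u\<in>fst H. \<forall>v\<in>fst H.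
     (\<forall>n\<in>{..r}. (u, v) \<notin> adj (snd H) ^^ n) \<longrightarrow> tau (snd H) p u v \<le> inverse (real (Suc k)))" for H
  proof
    assume "decays H p"
    then show "\<forall>k::nat. \<exists>r::nat. \<forall>u\<in>fst H. \<forall>v\<in>fst H.
     (\<forall>n\<in>{..r}. (u, v) \<notin> adj (snd H) ^^ n) \<longrightarrow> tau (snd H) p u v \<le> inverse (real (Suc k))"
      unfolding decays_def atMost_iff Ball_def by (intro allI) (simp del: of_nat_Suc)
  next
    assume a: "\<forall>k::nat. \<exists>r::nat. \<forall>u\<in>fst H. \<forall>v\<in>fst H.
     (\<forall>n\<in>{..r}. (u, v) \<notin> adj (snd H) ^^ n) \<longrightarrow> tau (snd H) p u v \<le> inverse (real (Suc k))"
    show "decays H p"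
      unfolding decays_def
    proof (intro allI impI)
      fix e :: real assume "e > 0"
      then obtain k where k: "inverse (real (Suc k)) < e" using reals_Archimedean by blast
      obtain r where "\<forall>u\<in>fst H. \<forall>v\<in>fst H.
        (\<forall>n\<in>{..r}. (u, v) \<notin> adj (snd H) ^^ n) \<longrightarrow> tau (snd H) p u v \<le> inverse (real (Suc k))"
        using a by blast
      then show "\<exists>r::nat. \<forall>u\<in>fst H. \<forall>v\<in>fst H.
        (\<forall>n\<le>r. (u, v) \<notin> adj (snd H) ^^ n) \<longrightarrow> tau (snd H) p u v \<le> e"
        using k by (intro exI[of _ r]) force
    qed
  qed
  show ?thesis
    unfolding eq
    by (intro pred_intros_countable pred_vertices pred_intros_logic pred_intros_finite) measurable
qed

text \<open>Decay passes to smaller parameters, so a sequence tending to 1 suffices and the event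
  becomes a countable intersection.\<close>

lemma p_conn_eq_1_countable:
  assumes "H \<in> space KS"
  shows "p_conn H = 1 \<longleftrightarrow> (\<forall>k. decays H (1 - inverse (real (Suc k))))"
proof -
  note sub = snd_sub_carrier[OF assms]
  have iff: "p_conn H = 1 \<longleftrightarrow> (\<forall>p. 0 \<le> p \<and> p < 1 \<longrightarrow> decays H p)"
    by (rule p_conn_eq_1_iff[OF countable_carrier sub])
  show ?thesis
  proof
    assume "p_conn H = 1"
    then show "\<forall>k. decays H (1 - inverse (real (Suc k)))"
      unfolding iff by (simp add: inverse_le_1_iff del: of_nat_Suc)
  next
    assume a: "\<forall>k. decays H (1 - inverse (real (Suc k)))"
    show "p_conn H = 1"
      unfolding iff
    proof (intro allI impI)
      fix p :: real assume p: "0 \<le> p \<and> p < 1"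
      then obtain k where "inverse (real (Suc k)) < 1 - p" using reals_Archimedean[of "1 - p"] by auto
      then show "decays H p"
        using decays_mono[where H = H, OF _ _ countable_carrier sub, of "1 - inverse (real (Suc k))" p] a by auto
    qed
  qed
qed

lemma pred_p_conn: "Measurable.pred KS (\<lambda>H. p_conn H = 1)"
proof -
  have "Measurable.pred KS (\<lambda>H. \<forall>k. decays H (1 - inverse (real (Suc k))))"
    by (intro pred_intros_countable pred_decays)
  then show ?thesis by (rule pred_transfer) (rule p_conn_eq_1_countable)
qed

section \<open>Translations of subgraphs\<close>

lemma inj_translate: "g \<in> carrier G \<Longrightarrow> inj_on (\<lambda>x. g \<otimes> x) (carrier G)"
  by (rule inj_onI) simp

lemma translate_space: 
  assumes g: "g \<in> carrier G" and H: "H \<in> space KS"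
  shows "translate G g H \<in> space KS"
proof -
  have "(\<lambda>x. g \<otimes> x) ` e \<in> snd K" if "e \<in> snd H" for e
  proof -
    have "e \<in> snd K" using snd_sub[OF H that] .
    then obtain x s where "x \<in> carrier G" "s \<in> S" "e = {x, x \<otimes> s}"
      by (auto simp: cayley_graph_def)
    moreover from this have "g \<otimes> (x \<otimes> s) = g \<otimes> x \<otimes> s" using g S_sub by (simp add: m_assoc subsetD)
    ultimately show ?thesis using g by (auto simp: edge_iff)
  qed
  moreover have "(\<lambda>x. g \<otimes> x) ` fst H \<subseteq> carrier G" using fst_sub[OF H] g by auto
  moreover have "(\<lambda>x. g \<otimes> x) ` e \<subseteq> (\<lambda>x. g \<otimes> x) ` fst H" if "e \<in> snd H" for e
    using snd_sub_fst[OF H that] by auto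
  ultimately show ?thesis by (auto simp: space_KS is_subgraph_def translate_def)
qed

lemma mult_image_inv:
  "g \<in> carrier G \<Longrightarrow> A \<subseteq> carrier G \<Longrightarrow> (\<lambda>x. inv g \<otimes> x) ` (\<lambda>x. g \<otimes> x) ` A = A"
  by (force simp: image_iff m_assoc[symmetric])

lemma translate_inv:
  assumes g: "g \<in> carrier G" and H: "H \<in> space KS"
  shows "translate G (inv g) (translate G g H) = H"
proof -
  have "(\<lambda>e. (\<lambda>x. inv g \<otimes> x) ` e) ` (\<lambda>e. (\<lambda>x. g \<otimes> x) ` e) ` snd H = snd H"
    using mult_image_inv[OF g] snd_sub_carrier[OF H] by (force simp: image_iff)
  then show ?thesis
    using mult_image_inv[OF g fst_sub[OF H]] by (simp add: translate_def)
qed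

lemma vertex_translate:
  assumes g: "g \<in> carrier G" and H: "H \<in> space KS" and v: "v \<in> carrier G"
  shows "g \<otimes> v \<in> fst (translate G g H) \<longleftrightarrow> v \<in> fst H"
  using fst_sub[OF H] g v by (auto simp: translate_def image_iff)

lemma edge_translate:
  assumes g: "g \<in> carrier G" and H: "H \<in> space KS" and e: "e \<subseteq> carrier G"
  shows "(\<lambda>x. g \<otimes> x) ` e \<in> snd (translate G g H) \<longleftrightarrow> e \<in> snd H"
proof -
  have "(\<lambda>x. g \<otimes> x) ` e = (\<lambda>x. g \<otimes> x) ` e' \<longleftrightarrow> e = e'" if "e' \<in> snd H" for e'
    using inj_on_image_eq_iff[OF inj_translate[OF g] e snd_sub_carrier[OF H that]] .
  then show ?thesis by (auto simp: translate_def image_iff)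
qed

lemma translate_measurable [measurable]:
  assumes g: "g \<in> carrier G"
  shows "translate G g \<in> measurable KS KS"
proof (rule measurable_into_KS)
  show "translate G g \<in> space KS \<rightarrow> space KS" using translate_space[OF g] by auto
  have i: "inv g \<in> carrier G" using g by simp
  fix v assume v: "v \<in> carrier G"
  have "v \<in> fst (translate G g H) \<longleftrightarrow> inv g \<otimes> v \<in> fst H" if "H \<in> space KS" for H
    using vertex_translate[OF g that, of "inv g \<otimes> v"] g v by (simp add: m_assoc[symmetric])
  then show "Measurable.pred KS (\<lambda>H. v \<in> fst (translate G g H))"
    by (rule pred_transfer[OF pred_vertex])
next
  fix e assume "e \<in> snd K"
  then have e: "e \<subseteq> carrier G" by (rule edge_sub)
  then have e': "(\<lambda>x. inv g \<otimes> x) ` e \<subseteq> carrier G" using g by auto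
  have "(\<lambda>x. g \<otimes> x) ` (\<lambda>x. inv g \<otimes> x) ` e = e"
    using mult_image_inv[of "inv g" e] g e by simp
  then have "e \<in> snd (translate G g H) \<longleftrightarrow> (\<lambda>x. inv g \<otimes> x) ` e \<in> snd H" if "H \<in> space KS" for H
    using edge_translate[OF g that e'] by simp
  then show "Measurable.pred KS (\<lambda>H. e \<in> snd (translate G g H))"
    by (rule pred_transfer[OF pred_edge])
qed

lemma tau_translate:
  assumes g: "g \<in> carrier G" and H: "H \<in> space KS" and p: "0 \<le> p" "p \<le> 1"
    and uv: "u \<in> carrier G" "v \<in> carrier G"
  shows "tau (snd (translate G g H)) p (g \<otimes> u) (g \<otimes> v) = tau (snd H) p u v"
  using tau_image[OF p countable_carrier inj_translate[OF g] snd_sub_carrier[OF H] uv]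
  by (simp add: translate_def)

lemma decays_translate:
  assumes g: "g \<in> carrier G" and H: "H \<in> space KS" and p: "0 \<le> p" "p \<le> 1" and d: "decays H p"
  shows "decays (translate G g H) p"
  unfolding decays_def
proof (intro allI impI)
  fix e :: real assume "e > 0"
  then obtain r :: nat where r: "\<And>u v. u \<in> fst H \<Longrightarrow> v \<in> fst H \<Longrightarrow>
      (\<forall>n\<le>r. (u, v) \<notin> adj (snd H) ^^ n) \<Longrightarrow> tau (snd H) p u v \<le> e"
    using d unfolding decays_def by meson
  have "tau (snd (translate G g H)) p (g \<otimes> u) (g \<otimes> v) \<le> e"
    if uv: "u \<in> fst H" "v \<in> fst H"
      and far: "\<forall>n\<le>r. (g \<otimes> u, g \<otimes> v) \<notin> adj (snd (translate G g H)) ^^ n" for u v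
  proof -
    have c: "u \<in> carrier G" "v \<in> carrier G" using uv fst_sub[OF H] by auto
    have "\<forall>n\<le>r. (u, v) \<notin> adj (snd H) ^^ n"
      using far adj_image_relpow[OF inj_translate[OF g] snd_sub_carrier[OF H] c]
      by (simp add: translate_def)
    then show ?thesis using r[OF uv] tau_translate[OF g H p c] by simp
  qed
  then show "\<exists>r::nat. \<forall>u\<in>fst (translate G g H). \<forall>v\<in>fst (translate G g H).
      (\<forall>n\<le>r. (u, v) \<notin> adj (snd (translate G g H)) ^^ n) \<longrightarrow> tau (snd (translate G g H)) p u v \<le> e"
    by (intro exI[of _ r]) (auto simp: translate_def)
qed

text \<open>Invariance of the event on which the law is later conditioned.\<close>

lemma p_conn_translate:
  assumes g: "g \<in> carrier G" and H: "H \<in> space KS"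
  shows "p_conn (translate G g H) = 1 \<longleftrightarrow> p_conn H = 1"
proof -
  have iff: "p_conn H' = 1 \<longleftrightarrow> (\<forall>p. 0 \<le> p \<and> p < 1 \<longrightarrow> decays H' p)" if "H' \<in> space KS" for H'
    by (rule p_conn_eq_1_iff[OF countable_carrier snd_sub_carrier[OF that]])
  have "decays (translate G g H) p \<longleftrightarrow> decays H p" if "0 \<le> p" "p < 1" for p
    using decays_translate[OF g H, of p] that translate_inv[OF g H]
      decays_translate[OF _ translate_space[OF g H], of "inv g" p] g by auto
  then show ?thesis using iff[OF H] iff[OF translate_space[OF g H]] by blast
qed

lemma invariant_random_subgraphD:
  assumes "invariant_random_subgraph G S \<mu>"
  shows "prob_space \<mu>" "sets \<mu> = sets KS" "space \<mu> = space KS"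
    and "g \<in> carrier G \<Longrightarrow> distr \<mu> KS (translate G g) = \<mu>"
  using assms sets_eq_imp_space_eq[of \<mu> KS] by (auto simp: invariant_random_subgraph_def)

lemma random_spanning_imp_nonempty:
  assumes "random_spanning_pconn_1 G S"
  shows "random_nonempty_pconn_1_pos G S"
proof -
  from assms obtain \<mu> where \<mu>: "invariant_random_subgraph G S \<mu>"
    "AE \<omega> in \<mu>. graph_connected \<omega> \<and> fst \<omega> = carrier G" "AE \<omega> in \<mu>. p_conn \<omega> = 1"
    by (auto simp: random_spanning_pconn_1_def)
  note inv = invariant_random_subgraphD[OF \<mu>(1)]
  interpret prob_space \<mu> by (rule inv(1))
  have "{\<omega> \<in> space \<mu>. p_conn \<omega> = 1} \<in> sets \<mu>"
    using pred_p_conn inv by (simp add: pred_def)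
  then have "measure \<mu> {\<omega> \<in> space \<mu>. p_conn \<omega> = 1} = 1"
    using \<mu>(3) by (simp add: prob_Collect_eq_1)
  moreover have "AE \<omega> in \<mu>. graph_connected \<omega> \<and> fst \<omega> \<noteq> {}"
    using \<mu>(2) by eventually_elim auto
  ultimately show ?thesis using \<mu>(1) by (auto simp: random_nonempty_pconn_1_pos_def)
qed

section \<open>Conditioning and equivariant maps preserve invariance\<close>

lemma invariant_uniform_measure:
  assumes \<mu>: "invariant_random_subgraph G S \<mu>"
    and A: "A \<in> sets KS" "measure \<mu> A > 0"
    and inv: "\<And>g H. g \<in> carrier G \<Longrightarrow> H \<in> space KS \<Longrightarrow> translate G g H \<in> A \<longleftrightarrow> H \<in> A"
  shows "invariant_random_subgraph G S (uniform_measure \<mu> A)"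
proof -
  note D = invariant_random_subgraphD[OF \<mu>]
  interpret prob_space \<mu> by (rule D(1))
  have A0: "emeasure \<mu> A \<noteq> 0" using A by (simp add: emeasure_eq_measure)
  have "distr (uniform_measure \<mu> A) KS (translate G g) = uniform_measure \<mu> A" if g: "g \<in> carrier G" for g
  proof (rule measure_eqI)
    show "sets (distr (uniform_measure \<mu> A) KS (translate G g)) = sets (uniform_measure \<mu> A)"
      using D by simp
    fix B assume "B \<in> sets (distr (uniform_measure \<mu> A) KS (translate G g))"
    then have B: "B \<in> sets KS" by simp
    have t: "translate G g \<in> measurable \<mu> KS"
      using translate_measurable[OF g] unfolding measurable_cong_sets[OF D(2) refl] .
    then have t': "translate G g \<in> measurable (uniform_measure \<mu> A) KS"
      by (simp add: measurable_def)
    have tB: "translate G g -` B \<inter> space \<mu> \<in> sets \<mu>" using measurable_sets[OF t B] .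
    have "emeasure (distr (uniform_measure \<mu> A) KS (translate G g)) B
        = emeasure (uniform_measure \<mu> A) (translate G g -` B \<inter> space \<mu>)"
      using t' B by (simp add: emeasure_distr)
    also have "\<dots> = emeasure \<mu> (A \<inter> (translate G g -` B \<inter> space \<mu>)) / emeasure \<mu> A"
      using A D(2) tB by simp
    \<comment> \<open>Since \<open>A\<close> is invariant, intersecting with it commutes with the
      pullback.\<close>
    also have "A \<inter> (translate G g -` B \<inter> space \<mu>) = translate G g -` (A \<inter> B) \<inter> space \<mu>"
      unfolding D(3) using inv[OF g] by blast
    also have "emeasure \<mu> \<dots> = emeasure (distr \<mu> KS (translate G g)) (A \<inter> B)"
      using t A B by (simp add: emeasure_distr)
    also have "\<dots> = emeasure \<mu> (A \<inter> B)" using D(4)[OF g] by simp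
    also have "\<dots> / emeasure \<mu> A = emeasure (uniform_measure \<mu> A) B"
      using A B D(2) by simp
    finally show "emeasure (distr (uniform_measure \<mu> A) KS (translate G g)) B
        = emeasure (uniform_measure \<mu> A) B" .
  qed
  then show ?thesis
    using A0 D(2) prob_space_uniform_measure[of \<mu> A]
    by (simp add: invariant_random_subgraph_def emeasure_eq_measure)
qed

lemma invariant_distr:
  assumes \<mu>: "invariant_random_subgraph G S \<mu>" and f: "f \<in> measurable KS KS"
    and comm: "\<And>g H. g \<in> carrier G \<Longrightarrow> H \<in> space KS \<Longrightarrow> f (translate G g H) = translate G g (f H)"
  shows "invariant_random_subgraph G S (distr \<mu> KS f)"
proof -
  note D = invariant_random_subgraphD[OF \<mu>]
  interpret prob_space \<mu> by (rule D(1))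
  have f': "f \<in> measurable \<mu> KS" using f unfolding measurable_cong_sets[OF D(2) refl] .
  have "distr (distr \<mu> KS f) KS (translate G g) = distr \<mu> KS f" if g: "g \<in> carrier G" for g
  proof -
    have t: "translate G g \<in> measurable \<mu> KS"
      using translate_measurable[OF g] unfolding measurable_cong_sets[OF D(2) refl] .
    have "distr (distr \<mu> KS f) KS (translate G g) = distr \<mu> KS (translate G g \<circ> f)"
      by (rule distr_distr[OF translate_measurable[OF g] f'])
    also have "\<dots> = distr \<mu> KS (f \<circ> translate G g)"
      using comm[OF g] D(3) by (intro distr_cong) auto
    also have "\<dots> = distr (distr \<mu> KS (translate G g)) KS f"
      by (rule distr_distr[OF f t, symmetric])
    finally show ?thesis using D(4)[OF g] by simp
  qed
  then show ?thesis
    using prob_space_distr[OF f'] by (simp add: invariant_random_subgraph_def)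
qed

text \<open>A vertex outside \<open>H\<close> is joined to its neighbour closer to \<open>H\<close> along the first possible
  generator. Since left translations preserve the generators labelling the edges, this choice is
  equivariant.\<close>

primrec lev :: "'a graph \<Rightarrow> nat \<Rightarrow> 'a set" where
  "lev H 0 = fst H"
| "lev H (Suc n) = {g \<in> carrier G. g \<in> lev H n \<or> (\<exists>s\<in>S. g \<otimes> s \<in> lev H n)}"

text \<open>The set \<open>lev H n\<close> consists of the vertices within distance \<open>n\<close>
  of \<open>H\<close>, so a level separating the two ends says that \<open>g \<otimes> s\<close> is
  strictly closer to \<open>H\<close>. In terms of levels, measurability and equivariance are
  direct.\<close>

definition closer :: "'a graph \<Rightarrow> 'a \<Rightarrow> 'a \<Rightarrow> bool" where
  "closer H g s \<longleftrightarrow> (\<exists>n. g \<otimes> s \<in> lev H n \<and> g \<notin> lev H n)"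

definition chosen :: "'a graph \<Rightarrow> 'a \<Rightarrow> 'a \<Rightarrow> bool" where
  "chosen H g s \<longleftrightarrow> s \<in> S \<and> closer H g s \<and> (\<forall>t\<in>S. closer H g t \<longrightarrow> to_nat_on S s \<le> to_nat_on S t)"

definition extend :: "'a graph \<Rightarrow> 'a graph" where
  "extend H = (carrier G, snd H \<union> {{g, g \<otimes> s} |g s. g \<in> carrier G \<and> chosen H g s})"

lemma pred_lev: "Measurable.pred KS (\<lambda>H. g \<in> lev H n)"
proof (induction n arbitrary: g)
  case (Suc n)
  show ?case unfolding lev.simps mem_Collect_eq
    by (intro pred_intros_logic pred_countable_Bex countable_finite[OF finite_S] Suc measurable_const) simp
qed (simp add: pred_vertex)

lemma pred_closer: "Measurable.pred KS (\<lambda>H. closer H g s)"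
  unfolding closer_def by (intro pred_intros_countable pred_intros_logic pred_lev)

lemma pred_chosen: "Measurable.pred KS (\<lambda>H. chosen H g s)"
  unfolding chosen_def
  by (intro pred_intros_logic pred_countable_Ball countable_finite[OF finite_S] pred_closer measurable_const) simp_all

lemma extend_space:
  assumes H: "H \<in> space KS"
  shows "extend H \<in> space KS"
proof -
  have "e \<in> snd K" if "e \<in> snd (extend H)" for e
  proof -
    from that consider "e \<in> snd H" | g s where "g \<in> carrier G" "s \<in> S" "e = {g, g \<otimes> s}"
      by (auto simp: extend_def chosen_def)
    then show ?thesis
    proof cases
      case 1
      then show ?thesis by (rule snd_sub[OF H])
    next
      case 2
      then show ?thesis by (simp add: edge_iff) blast
    qed
  qed
  moreover from this have "e \<subseteq> carrier G" if "e \<in> snd (extend H)" for e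
    using edge_sub that by blast
  ultimately show ?thesis by (simp add: space_KS is_subgraph_def extend_def) blast
qed

lemma extend_measurable: "extend \<in> measurable KS KS"
proof (rule measurable_into_KS)
  show "extend \<in> space KS \<rightarrow> space KS" using extend_space by auto
  show "Measurable.pred KS (\<lambda>H. v \<in> fst (extend H))" if "v \<in> carrier G" for v
    using that by (simp add: extend_def)
  fix e
  have "e \<in> snd (extend H) \<longleftrightarrow> e \<in> snd H \<or> (\<exists>g\<in>carrier G. \<exists>s\<in>S. e = {g, g \<otimes> s} \<and> chosen H g s)" for H
    by (auto simp: extend_def chosen_def)
  moreover have "Measurable.pred KS (\<lambda>H. e \<in> snd H \<or>
      (\<exists>g\<in>carrier G. \<exists>s\<in>S. e = {g, g \<otimes> s} \<and> chosen H g s))"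
    by (intro pred_intros_logic pred_countable_Bex countable_finite[OF finite_S] countable_carrier
        pred_chosen pred_edge measurable_const) simp
  ultimately show "Measurable.pred KS (\<lambda>H. e \<in> snd (extend H))" by simp
qed

lemma lev_translate:
  assumes g: "g \<in> carrier G" and H: "H \<in> space KS"
  shows "x \<in> carrier G \<Longrightarrow> g \<otimes> x \<in> lev (translate G g H) n \<longleftrightarrow> x \<in> lev H n"
proof (induction n arbitrary: x)
  case 0
  then show ?case using vertex_translate[OF g H] by simp
next
  case (Suc n)
  have "g \<otimes> x \<otimes> s \<in> lev (translate G g H) n \<longleftrightarrow> x \<otimes> s \<in> lev H n" if "s \<in> S" for s
  proof -
    have s: "s \<in> carrier G" using that S_sub by auto
    then show ?thesis using Suc.IH[of "x \<otimes> s"] Suc.prems g by (simp add: m_assoc)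
  qed
  then show ?case using Suc g by simp
qed

lemma chosen_translate:
  assumes g: "g \<in> carrier G" and H: "H \<in> space KS" and x: "x \<in> carrier G"
  shows "chosen (translate G g H) (g \<otimes> x) s \<longleftrightarrow> chosen H x s"
proof -
  have "closer (translate G g H) (g \<otimes> x) s \<longleftrightarrow> closer H x s" if "s \<in> S" for s
  proof -
    have s: "s \<in> carrier G" using that S_sub by auto
    then show ?thesis unfolding closer_def
      using lev_translate[OF g H, of "x \<otimes> s"] lev_translate[OF g H x] x g by (simp add: m_assoc)
  qed
  then show ?thesis by (auto simp: chosen_def)
qed

lemma extend_translate:
  assumes g: "g \<in> carrier G" and H: "H \<in> space KS"
  shows "extend (translate G g H) = translate G g (extend H)"
proof -
  have surj: "(\<lambda>x. g \<otimes> x) ` carrier G = carrier G"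
  proof
    show "carrier G \<subseteq> (\<lambda>x. g \<otimes> x) ` carrier G"
    proof
      fix y assume "y \<in> carrier G"
      then have "y = g \<otimes> (inv g \<otimes> y)" "inv g \<otimes> y \<in> carrier G"
        using g by (simp_all add: m_assoc[symmetric])
      then show "y \<in> (\<lambda>x. g \<otimes> x) ` carrier G" by (rule image_eqI)
    qed
  qed (use g in auto)
  have "{{y, y \<otimes> s} |y s. y \<in> carrier G \<and> chosen (translate G g H) y s}
      = {{g \<otimes> x, g \<otimes> x \<otimes> s} |x s. x \<in> carrier G \<and> chosen (translate G g H) (g \<otimes> x) s}"
    (is "?L = ?R")
  proof
    show "?R \<subseteq> ?L" using g by blast
    show "?L \<subseteq> ?R"
    proof clarify
      fix y s assume y: "y \<in> carrier G" "chosen (translate G g H) y s"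
      then obtain x where "x \<in> carrier G" "y = g \<otimes> x" using surj by blast
      then show "\<exists>x s'. {y, y \<otimes> s} = {g \<otimes> x, g \<otimes> x \<otimes> s'} \<and> x \<in> carrier G \<and> chosen (translate G g H) (g \<otimes> x) s'"
        using y by blast
    qed
  qed
  also have "\<dots> = {{g \<otimes> x, g \<otimes> x \<otimes> s} |x s. x \<in> carrier G \<and> chosen H x s}"
    using chosen_translate[OF g H] by blast
  also have "\<dots> = (\<lambda>e. (\<lambda>x. g \<otimes> x) ` e) ` {{x, x \<otimes> s} |x s. x \<in> carrier G \<and> chosen H x s}"
    (is "?L = ?R")
  proof -
    have eq: "{g \<otimes> x, g \<otimes> x \<otimes> s} = (\<lambda>x. g \<otimes> x) ` {x, x \<otimes> s}" if "x \<in> carrier G" "chosen H x s" for x s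
      using that g S_sub by (auto simp: chosen_def m_assoc subsetD)
    show ?thesis
    proof (intro equalityI subsetI)
      fix e assume "e \<in> ?L"
      then obtain x s where x: "x \<in> carrier G" "chosen H x s" "e = {g \<otimes> x, g \<otimes> x \<otimes> s}" by blast
      then have "e = (\<lambda>x. g \<otimes> x) ` {x, x \<otimes> s}" using eq by simp
      moreover have "{x, x \<otimes> s} \<in> {{x, x \<otimes> s} |x s. x \<in> carrier G \<and> chosen H x s}"
        using x by blast
      ultimately show "e \<in> ?R" by (rule image_eqI)
    next
      fix e assume "e \<in> ?R"
      then obtain x s where x: "x \<in> carrier G" "chosen H x s" "e = (\<lambda>x. g \<otimes> x) ` {x, x \<otimes> s}" by blast
      then show "e \<in> ?L" unfolding x(3) eq[OF x(1,2), symmetric] by blast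
    qed
  qed
  finally show ?thesis using surj by (simp add: extend_def translate_def image_Un)
qed

lemma lev_mono: "H \<in> space KS \<Longrightarrow> m \<le> n \<Longrightarrow> lev H m \<subseteq> lev H n"
proof (induction n)
  case (Suc n)
  have "lev H n \<subseteq> carrier G" using fst_sub[OF Suc.prems(1)] by (cases n) auto
  then have "lev H n \<subseteq> lev H (Suc n)" by auto
  then show ?case using Suc by (cases "m = Suc n") auto
qed simp

lemma lev_exhausts:
  assumes H: "H \<in> space KS" and ne: "fst H \<noteq> {}" and g: "g \<in> carrier G"
  shows "\<exists>n. g \<in> lev H n"
proof -
  obtain v where v: "v \<in> fst H" using ne by auto
  have "(g, v) \<in> (adj (snd K))\<^sup>*" using K_connected[OF g] v fst_sub[OF H] by auto
  then show ?thesis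
  proof (induction rule: converse_rtrancl_induct)
    case base
    then show ?case using v by (intro exI[of _ 0]) simp
  next
    case (step y w)
    then obtain n where "w \<in> lev H n" by auto
    then have "y \<in> lev H (Suc n)" using step(1) by (auto simp: adj_def edge_iff)
    then show ?case by blast
  qed
qed

text \<open>The least level containing \<open>g\<close> is positive, so a neighbour of
  \<open>g\<close> lies one level below; the injective numbering of \<open>S\<close> breaks
  ties.\<close>

lemma chosen_ex1:
  assumes H: "H \<in> space KS" and ne: "fst H \<noteq> {}" and g: "g \<in> carrier G" "g \<notin> fst H"
  shows "\<exists>!s. chosen H g s"
proof -
  define n where "n = (LEAST n. g \<in> lev H n)"
  have n: "g \<in> lev H n" unfolding n_def using lev_exhausts[OF H ne g(1)] by (rule LeastI_ex)
  then obtain m where m: "n = Suc m" using g by (cases n) auto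
  have nm: "g \<notin> lev H m" using not_less_Least[of m "\<lambda>n. g \<in> lev H n"] m by (simp add: n_def)
  then obtain s0 where "s0 \<in> S" "closer H g s0" using n m by (auto simp: closer_def)
  then obtain s where "s \<in> S \<and> closer H g s" "\<forall>t. t \<in> S \<and> closer H g t \<longrightarrow> to_nat_on S s \<le> to_nat_on S t"
    using ex_has_least_nat[of "\<lambda>s. s \<in> S \<and> closer H g s" s0 "to_nat_on S"] by blast
  then have s: "chosen H g s" by (auto simp: chosen_def)
  moreover have "t = s" if "chosen H g t" for t
  proof (rule inj_onD[OF inj_on_to_nat_on[OF countable_finite[OF finite_S]]])
    show "to_nat_on S t = to_nat_on S s" using that s unfolding chosen_def by (meson le_antisym)
  qed (use that s in \<open>auto simp: chosen_def\<close>)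
  ultimately show ?thesis by blast
qed

lemma extend_good:
  assumes H: "H \<in> space KS" and ne: "fst H \<noteq> {}" and con: "graph_connected H" and pc: "p_conn H = 1"
  shows "graph_connected (extend H)" and "p_conn (extend H) = 1"
proof -
  define sel where "sel g = (THE s. chosen H g s)" for g
  define par where "par g = (if g \<in> fst H then g else g \<otimes> sel g)" for g
  define h where "h g = (LEAST n. g \<in> lev H n)" for g
  have sel: "chosen H g (sel g)" if "g \<in> carrier G" "g \<notin> fst H" for g
    unfolding sel_def by (rule theI'[OF chosen_ex1[OF H ne that]])
  \<comment> \<open>Vertices of \<open>H\<close> lie in every level, so no generator is chosen at
    them and the new edges are exactly the parent edges.\<close>
  have chosen_sel: "g \<notin> fst H \<and> sel g = s" if "g \<in> carrier G" "chosen H g s" for g s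
  proof -
    have g: "g \<notin> fst H"
      using that(2) lev_mono[OF H, of 0] by (auto simp: chosen_def closer_def)
    then show ?thesis using chosen_ex1[OF H ne that(1) g] sel[OF that(1) g] that(2) by blast
  qed
  have par: "par g = g \<otimes> sel g" if "g \<notin> fst H" for g
    using that by (simp add: par_def)
  interpret hanging_forest "fst H" "carrier G" "snd H" par h
  proof
    show "fst H \<subseteq> carrier G" by (rule fst_sub[OF H])
    show "countable (carrier G)" by (rule countable_carrier)
    show "e \<subseteq> fst H" if "e \<in> snd H" for e using snd_sub_fst[OF H that] .
    show "par g = g" if "g \<in> fst H" for g using that by (simp add: par_def)
    show "par g \<in> carrier G" if "g \<in> carrier G" for g
    proof (cases "g \<in> fst H")
      case False
      then have "sel g \<in> carrier G" using sel[OF that] S_sub by (auto simp: chosen_def)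
      then show ?thesis using par[OF False] that by simp
    qed (simp add: par_def that)
    show "h (par g) < h g" if g: "g \<in> carrier G" "g \<notin> fst H" for g
    proof -
      obtain n where n: "par g \<in> lev H n" "g \<notin> lev H n"
        using sel[OF g] par[OF g(2)] by (auto simp: chosen_def closer_def)
      have "h (par g) \<le> n" unfolding h_def by (rule Least_le[where P = "\<lambda>n. par g \<in> lev H n", OF n(1)])
      moreover have "g \<in> lev H (h g)" unfolding h_def using lev_exhausts[OF H ne g(1)] by (rule LeastI_ex)
      then have "\<not> h g \<le> n" using lev_mono[OF H] n(2) by blast
      ultimately show ?thesis by simp
    qed
  qed
  have ext: "extend H = (carrier G, full)"
  proof -
    have "{{g, g \<otimes> s} |g s. g \<in> carrier G \<and> chosen H g s} = {{g, par g} |g. g \<in> carrier G - fst H}"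
    proof (intro equalityI subsetI)
      fix e assume "e \<in> {{g, g \<otimes> s} |g s. g \<in> carrier G \<and> chosen H g s}"
      then obtain g s where g: "g \<in> carrier G" "chosen H g s" "e = {g, g \<otimes> s}" by blast
      have "g \<notin> fst H" "sel g = s" using chosen_sel[OF g(1,2)] by simp_all
      then have "g \<in> carrier G - fst H" "e = {g, par g}" using g par[of g] by simp_all
      then show "e \<in> {{g, par g} |g. g \<in> carrier G - fst H}" by blast
    next
      fix e assume "e \<in> {{g, par g} |g. g \<in> carrier G - fst H}"
      then obtain g where g: "g \<in> carrier G" "g \<notin> fst H" "e = {g, par g}" by blast
      have "chosen H g (sel g)" "e = {g, g \<otimes> sel g}" using sel[OF g(1,2)] par[OF g(2)] g(3) by simp_all
      then show "e \<in> {{g, g \<otimes> s} |g s. g \<in> carrier G \<and> chosen H g s}" using g(1) by blast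
    qed
    then show ?thesis by (simp add: extend_def full_def)
  qed
  show "graph_connected (extend H)" unfolding ext using con by (intro full_connected) simp
  have iff: "p_conn H' = 1 \<longleftrightarrow> (\<forall>p. 0 \<le> p \<and> p < 1 \<longrightarrow> decays H' p)" if "H' \<in> space KS" for H'
    by (rule p_conn_eq_1_iff[OF countable_carrier snd_sub_carrier[OF that]])
  show "p_conn (extend H) = 1"
    using pc full_decays iff[OF H] iff[OF extend_space[OF H]] by (simp add: ext)
qed

lemma random_nonempty_imp_spanning:
  assumes "random_nonempty_pconn_1_pos G S"
  shows "random_spanning_pconn_1 G S"
proof -
  from assms obtain \<mu> where \<mu>: "invariant_random_subgraph G S \<mu>"
    "AE \<omega> in \<mu>. graph_connected \<omega> \<and> fst \<omega> \<noteq> {}" "measure \<mu> {\<omega> \<in> space \<mu>. p_conn \<omega> = 1} > 0"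
    by (auto simp: random_nonempty_pconn_1_pos_def)
  note D = invariant_random_subgraphD[OF \<mu>(1)]
  define A where "A = {\<omega> \<in> space KS. p_conn \<omega> = 1}"
  have A: "A \<in> sets KS" unfolding A_def using pred_p_conn by (simp add: pred_def)
  have "translate G g H \<in> A \<longleftrightarrow> H \<in> A" if "g \<in> carrier G" "H \<in> space KS" for g H
    using p_conn_translate[OF that] translate_space[OF that] that by (simp add: A_def)
  then have inv: "invariant_random_subgraph G S (uniform_measure \<mu> A)"
    using \<mu> A D by (intro invariant_uniform_measure) (auto simp: A_def)
  define \<nu> where "\<nu> = distr (uniform_measure \<mu> A) KS extend"
  have inv': "invariant_random_subgraph G S \<nu>"
    unfolding \<nu>_def by (rule invariant_distr[OF inv extend_measurable extend_translate])
  have "AE \<omega> in uniform_measure \<mu> A. \<omega> \<in> space KS \<and> p_conn \<omega> = 1 \<and> graph_connected \<omega> \<and> fst \<omega> \<noteq> {}"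
  proof (rule AE_uniform_measureI)
    show "A \<in> sets \<mu>" using A D by simp
    show "AE \<omega> in \<mu>. \<omega> \<in> A \<longrightarrow> \<omega> \<in> space KS \<and> p_conn \<omega> = 1 \<and> graph_connected \<omega> \<and> fst \<omega> \<noteq> {}"
      using \<mu>(2) by eventually_elim (simp add: A_def)
  qed
  then have good: "AE \<omega> in uniform_measure \<mu> A. graph_connected (extend \<omega>) \<and> p_conn (extend \<omega>) = 1"
    by eventually_elim (auto intro: extend_good)
  have ext: "extend \<in> measurable (uniform_measure \<mu> A) KS"
    using extend_measurable unfolding measurable_cong_sets[OF invariant_random_subgraphD(2)[OF inv] refl] .
  have "Measurable.pred KS (\<lambda>\<omega>. graph_connected \<omega> \<and> fst \<omega> = carrier G)"
  proof -
    have "Measurable.pred KS (\<lambda>\<omega>. graph_connected \<omega> \<and> (\<forall>v\<in>carrier G. v \<in> fst \<omega>))"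
      by (intro pred_intros_logic pred_connected pred_countable_Ball countable_carrier pred_vertex)
    then show ?thesis by (rule pred_transfer) (use fst_sub in blast)
  qed
  then have "AE \<omega> in \<nu>. graph_connected \<omega> \<and> fst \<omega> = carrier G"
    unfolding \<nu>_def using good by (subst AE_distr_iff[OF ext]) (auto simp: pred_def extend_def)
  moreover have "AE \<omega> in \<nu>. p_conn \<omega> = 1"
    unfolding \<nu>_def using good pred_p_conn by (subst AE_distr_iff[OF ext]) (auto simp: pred_def)
  ultimately show ?thesis using inv' by (auto simp: random_spanning_pconn_1_def)
qed

end

section \<open>Positive definiteness of the two-point function\<close>

lemma ev_sum: "ev (\<lambda>x. \<Sum>k\<in>I. f k x) c = (\<Sum>k\<in>I. ev (f k) c)"
proof (induction I rule: infinite_finite_induct)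
  case (insert k I)
  then show ?case using ev_add[of "f k" "\<lambda>x. \<Sum>k\<in>I. f k x" c] by simp
qed (simp_all add: ev_const[of 0, simplified])

lemma ev_cong:
  "(\<And>a x y. (a, x, y) \<in> set c \<Longrightarrow> f x = g x \<and> f y = g y) \<Longrightarrow> ev f c = ev g c"
proof (induction c)
  case (Cons t c)
  obtain a x y where t: "t = (a, x, y)" by (cases t)
  have "f x = g x \<and> f y = g y" using Cons.prems[of a x y] t by simp
  moreover have "ev f c = ev g c" by (rule Cons.IH) (use Cons.prems in auto)
  ultimately show ?case by (simp add: t)
qed simp

text \<open>On the support of \<open>c\<close>, the indicator of an equivalence relation is a finite sum of kernels
  \<open>g\<^sub>k x * g\<^sub>k y\<close>, one for each class.\<close>

lemma ev_classes_nonneg: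
  "0 \<le> ev (\<lambda>x. ev (\<lambda>y. if r x = r y then 1 else 0) c) c"
proof -
  define I where "I = r ` (\<Union>(a, x, y)\<in>set c. {x, y})"
  define g where "g k x = (if r x = k then 1 else 0 :: real)" for k x
  have fin: "finite I" unfolding I_def by (auto intro!: finite_imageI)
  have "(if r x = r y then 1 else 0) = (\<Sum>k\<in>I. g k x * g k y)" if "r x \<in> I" for x y
  proof -
    have "(\<Sum>k\<in>I. g k x * g k y) = (\<Sum>k\<in>I. if r x = k then g k y else 0)"
      by (rule sum.cong) (auto simp: g_def)
    also have "\<dots> = g (r x) y" using fin that by simp
    finally show ?thesis by (simp add: g_def)
  qed
  then have "ev (\<lambda>y. if r x = r y then 1 else 0) c = ev (\<lambda>y. \<Sum>k\<in>I. g k x * g k y) c" if "r x \<in> I" for x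
    using that by simp
  moreover have "r x \<in> I \<and> r y \<in> I" if "(a, x, y) \<in> set c" for a x y
    using that by (force simp: I_def)
  ultimately have "ev (\<lambda>x. ev (\<lambda>y. if r x = r y then 1 else 0) c) c
      = ev (\<lambda>x. ev (\<lambda>y. \<Sum>k\<in>I. g k x * g k y) c) c"
    by (intro ev_cong) blast
  also have "\<dots> = ev (\<lambda>x. \<Sum>k\<in>I. ev (g k) c * g k x) c"
    by (simp add: ev_sum ev_mult mult.commute)
  also have "\<dots> = (\<Sum>k\<in>I. ev (g k) c * ev (g k) c)"
    by (simp add: ev_sum ev_mult)
  also have "\<dots> \<ge> 0" by (intro sum_nonneg) simp
  finally show ?thesis .
qed

lemma ev_integral:
  assumes "\<And>x. integrable M (\<lambda>\<omega>. f \<omega> x)"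
  shows "integrable M (\<lambda>\<omega>. ev (f \<omega>) c)" and "(\<integral>\<omega>. ev (f \<omega>) c \<partial>M) = ev (\<lambda>x. \<integral>\<omega>. f \<omega> x \<partial>M) c"
proof -
  have "integrable M (\<lambda>\<omega>. ev (f \<omega>) c) \<and> (\<integral>\<omega>. ev (f \<omega>) c \<partial>M) = ev (\<lambda>x. \<integral>\<omega>. f \<omega> x \<partial>M) c"
  proof (induction c)
    case (Cons t c)
    obtain a x y where t: "t = (a, x, y)" by (cases t)
    show ?case unfolding t ev_simps using assms Cons by simp
  qed simp
  then show "integrable M (\<lambda>\<omega>. ev (f \<omega>) c)" "(\<integral>\<omega>. ev (f \<omega>) c \<partial>M) = ev (\<lambda>x. \<integral>\<omega>. f \<omega> x \<partial>M) c"
    by simp_all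
qed

text \<open>Applied twice: averaging over the labels gives positivity of \<open>tau\<close>, and
  averaging over the random subgraph gives positivity of its expectation.\<close>

lemma ev_ev_integral_nonneg:
  assumes int: "\<And>x y. integrable M (\<lambda>\<omega>. f \<omega> x y)"
    and pos: "\<And>\<omega>. \<omega> \<in> space M \<Longrightarrow> 0 \<le> ev (\<lambda>x. ev (\<lambda>y. f \<omega> x y) c) c"
  shows "0 \<le> ev (\<lambda>x. ev (\<lambda>y. \<integral>\<omega>. f \<omega> x y \<partial>M) c) c"
proof -
  have i: "integrable M (\<lambda>\<omega>. ev (\<lambda>y. f \<omega> x y) c)" for x by (rule ev_integral(1)[OF int])
  have "ev (\<lambda>x. ev (\<lambda>y. \<integral>\<omega>. f \<omega> x y \<partial>M) c) c = ev (\<lambda>x. \<integral>\<omega>. ev (\<lambda>y. f \<omega> x y) c \<partial>M) c"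
    by (simp add: ev_integral(2)[OF int])
  also have "\<dots> = (\<integral>\<omega>. ev (\<lambda>x. ev (\<lambda>y. f \<omega> x y) c) c \<partial>M)"
    by (rule ev_integral(2)[OF i, symmetric])
  also have "\<dots> \<ge> 0" using pos by (intro integral_nonneg_AE AE_I2)
  finally show ?thesis .
qed

lemma connected_iff_class:
  "(x, y) \<in> (adj E)\<^sup>* \<longleftrightarrow> (adj E)\<^sup>* `` {x} = (adj E)\<^sup>* `` {y}"
proof
  assume "(x, y) \<in> (adj E)\<^sup>*"
  moreover from this have "(y, x) \<in> (adj E)\<^sup>*" by (simp add: rtrancl_adj_sym)
  ultimately show "(adj E)\<^sup>* `` {x} = (adj E)\<^sup>* `` {y}" by (auto intro: rtrancl_trans)
qed auto

text \<open>For fixed labels, connection is an equivalence relation, and equality of classes is the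
  kernel of \<open>ev_classes_nonneg\<close>. The map \<open>k\<close> lets an enumeration of the
  vertices supply the index.\<close>

lemma tau_positive:
  assumes V: "countable V" "\<And>e. e \<in> E \<Longrightarrow> e \<subseteq> V"
  shows "0 \<le> ev (\<lambda>x. ev (\<lambda>y. tau E p (k x) (k y)) c) c"
proof -
  let ?A = "\<lambda>x y. {l. (k x, k y) \<in> (adj {e \<in> E. l e \<le> p})\<^sup>*}"
  have A: "?A x y \<in> sets labels" for x y by (rule connected_event[OF V])
  have "0 \<le> ev (\<lambda>x. ev (\<lambda>y. indicator (?A x y) l) c) c" for l
    using ev_classes_nonneg[of "\<lambda>x. (adj {e \<in> E. l e \<le> p})\<^sup>* `` {k x}" c]
    by (simp add: indicator_def of_bool_def connected_iff_class[symmetric])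
  then have "0 \<le> ev (\<lambda>x. ev (\<lambda>y. \<integral>l. indicator (?A x y) l \<partial>labels) c) c"
    by (intro ev_ev_integral_nonneg integrable_real_indicator A)
      (simp_all add: labels.emeasure_finite less_top[symmetric])
  then show ?thesis using A by (simp add: tau_def)
qed

section \<open>The Haagerup property\<close>

context cayley
begin

lemma spanning_imp_haagerup:
  assumes inf: "infinite (carrier G)" and "random_spanning_pconn_1 G S"
  shows "haagerup G"
proof -
  from assms(2) obtain \<mu> where \<mu>: "invariant_random_subgraph G S \<mu>"
    "AE \<omega> in \<mu>. graph_connected \<omega> \<and> fst \<omega> = carrier G" "AE \<omega> in \<mu>. p_conn \<omega> = 1"
    by (auto simp: random_spanning_pconn_1_def)
  note D = invariant_random_subgraphD[OF \<mu>(1)]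
  interpret prob_space \<mu> by (rule D(1))
  define \<phi> where "\<phi> p x y = (\<integral>\<omega>. tau (snd \<omega>) p x y \<partial>\<mu>)" for p x y
  have tau_meas: "(\<lambda>\<omega>. tau (snd \<omega>) p x y) \<in> borel_measurable \<mu>" for p x y
    using measurable_tau unfolding measurable_cong_sets[OF D(2) refl] .
  have tau_int: "integrable \<mu> (\<lambda>\<omega>. tau (snd \<omega>) p x y)" for p x y
    by (rule integrable_const_bound[of _ 1]) (auto intro: tau_meas)
  have \<phi>_le: "\<phi> p x y \<le> 1" for p x y
    unfolding \<phi>_def using integral_mono[OF tau_int, of "\<lambda>_. 1"] prob_space by simp
  have \<phi>_refl: "\<phi> p x x = 1" for p x using prob_space by (simp add: \<phi>_def)
  have \<phi>_sym: "\<phi> p x y = \<phi> p y x" for p x y by (simp add: \<phi>_def tau_sym)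
  have \<phi>_inv: "\<phi> p (g \<otimes> x) (g \<otimes> y) = \<phi> p x y"
    if "g \<in> carrier G" "x \<in> carrier G" "y \<in> carrier G" "0 \<le> p" "p \<le> 1" for p g x y
  proof -
    have t: "translate G g \<in> measurable \<mu> KS"
      using translate_measurable[OF that(1)] unfolding measurable_cong_sets[OF D(2) refl] .
    have "\<phi> p (g \<otimes> x) (g \<otimes> y) = (\<integral>\<omega>. tau (snd \<omega>) p (g \<otimes> x) (g \<otimes> y) \<partial>distr \<mu> KS (translate G g))"
      using D(4)[OF that(1)] by (simp add: \<phi>_def)
    also have "\<dots> = (\<integral>\<omega>. tau (snd (translate G g \<omega>)) p (g \<otimes> x) (g \<otimes> y) \<partial>\<mu>)"
      by (rule integral_distr[OF t measurable_tau])
    also have "\<dots> = \<phi> p x y"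
      unfolding \<phi>_def using that D(3) by (intro Bochner_Integration.integral_cong) (auto simp: tau_translate)
    finally show ?thesis .
  qed
  have \<phi>_lim: "(\<lambda>k. \<phi> (1 - inverse (real (Suc k))) x y) \<longlonglongrightarrow> 1"
    if xy: "x \<in> carrier G" "y \<in> carrier G" for x y
  proof -
    let ?q = "\<lambda>k. 1 - inverse (real (Suc k))"
    have q: "0 \<le> ?q k" "?q k \<le> 1" for k by (simp_all add: inverse_le_1_iff del: of_nat_Suc)
    have q1: "?q \<longlonglongrightarrow> 1" using tendsto_diff[OF tendsto_const LIMSEQ_inverse_real_of_nat, of 1] by simp
    have "(\<lambda>k. \<integral>\<omega>. tau (snd \<omega>) (?q k) x y \<partial>\<mu>) \<longlonglongrightarrow> (\<integral>\<omega>. 1 \<partial>\<mu>)"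
    proof (rule integral_dominated_convergence[where w = "\<lambda>_. 1"])
      have "AE \<omega> in \<mu>. \<omega> \<in> space KS" using D(3) by (auto intro: AE_I2)
      then show "AE \<omega> in \<mu>. (\<lambda>k. tau (snd \<omega>) (?q k) x y) \<longlonglongrightarrow> 1"
        using \<mu>(2)
      proof eventually_elim
        case (elim \<omega>)
        have "(x, y) \<in> (adj (snd \<omega>))\<^sup>*" using elim xy by (auto simp: graph_connected_def)
        \<comment> \<open>The edges of one finite path are all open with probability
          \<open>?q k ^ card F\<close>, which tends to 1. The path depends on \<omega>, so this
          limit is pointwise in \<omega>.\<close>
        from finite_edges_of_path[OF this]
        obtain F where F: "finite F" "F \<subseteq> snd \<omega>" "(x, y) \<in> (adj F)\<^sup>*" by (elim exE conjE)
        have lower: "?q k ^ card F \<le> tau (snd \<omega>) (?q k) x y" for k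
          by (rule tau_ge_power[OF countable_carrier snd_sub_carrier[OF elim(1)] F q])
        have "(\<lambda>k. ?q k ^ card F) \<longlonglongrightarrow> 1" using tendsto_power[OF q1, of "card F"] by simp
        then show ?case
          by (rule tendsto_sandwich[OF _ _ _ tendsto_const, rotated 2])
            (use lower in \<open>auto intro!: always_eventually\<close>)
      qed
    qed (auto intro: tau_meas)
    then show ?thesis using prob_space by (simp add: \<phi>_def)
  qed
  \<comment> \<open>An infinite set would contain an injective sequence along which the expectation
    stays above \<delta>, although almost every \<omega> makes its two-point function tend to 0
    along it.\<close>
  have \<phi>_c0: "finite {g \<in> carrier G. \<phi> p \<one> g > \<delta>}" if p: "0 \<le> p" "p < 1" and \<delta>: "\<delta> > 0" for p \<delta>
  proof (rule ccontr)
    assume "infinite {g \<in> carrier G. \<phi> p \<one> g > \<delta>}"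
    then obtain b :: "nat \<Rightarrow> 'a" where b: "inj b" "range b \<subseteq> {g \<in> carrier G. \<phi> p \<one> g > \<delta>}"
      using infinite_countable_subset by blast
    have "(\<lambda>n. \<integral>\<omega>. tau (snd \<omega>) p \<one> (b n) \<partial>\<mu>) \<longlonglongrightarrow> (\<integral>\<omega>. 0 \<partial>\<mu>)"
    proof (rule integral_dominated_convergence[where w = "\<lambda>_. 1"])
      have "AE \<omega> in \<mu>. \<omega> \<in> space KS" using D(3) by (auto intro: AE_I2)
      then show "AE \<omega> in \<mu>. (\<lambda>n. tau (snd \<omega>) p \<one> (b n)) \<longlonglongrightarrow> 0"
        using \<mu>(2,3)
      proof eventually_elim
        case (elim \<omega>)
        have "p_conn \<omega> = 1 \<longleftrightarrow> (\<forall>p. 0 \<le> p \<and> p < 1 \<longrightarrow> decays \<omega> p)"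
          by (rule p_conn_eq_1_iff[OF countable_carrier snd_sub_carrier[OF elim(1)]])
        then have dec: "decays \<omega> p" using elim p by simp
        show ?case
        proof (rule order_tendstoI)
          fix a :: real assume "0 < a"
          then obtain r :: nat where r: "\<And>u v. u \<in> fst \<omega> \<Longrightarrow> v \<in> fst \<omega> \<Longrightarrow>
              (\<forall>n\<le>r. (u, v) \<notin> adj (snd \<omega>) ^^ n) \<Longrightarrow> tau (snd \<omega>) p u v \<le> a / 2"
            using dec unfolding decays_def by (meson half_gt_zero)
          \<comment> \<open>The sequence leaves every ball of the Cayley graph; short walks in
            \<omega> stay inside such balls, so \<open>b n\<close> is eventually far from the
            identity in \<omega>.\<close>
          have "finite (b -` {y. \<exists>n\<le>r. (\<one>, y) \<in> adj (snd K) ^^ n})"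
            by (rule finite_vimageI[OF finite_ball b(1)])
          then have "\<forall>\<^sub>F n in sequentially. b n \<notin> {y. \<exists>n\<le>r. (\<one>, y) \<in> adj (snd K) ^^ n}"
            by (simp add: cofinite_eq_sequentially[symmetric] eventually_cofinite vimage_def)
          then show "\<forall>\<^sub>F n in sequentially. tau (snd \<omega>) p \<one> (b n) < a"
          proof eventually_elim
            case (elim n)
            have "\<forall>m\<le>r. (\<one>, b n) \<notin> adj (snd \<omega>) ^^ m"
              using elim relpow_adj_mono[of "snd \<omega>" "snd K"] snd_sub[OF \<open>\<omega> \<in> space KS\<close>] by blast
            moreover have "\<one> \<in> fst \<omega>" "b n \<in> fst \<omega>"
              using b(2) \<open>graph_connected \<omega> \<and> fst \<omega> = carrier G\<close> by auto
            ultimately have "tau (snd \<omega>) p \<one> (b n) \<le> a / 2" using r by blast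
            then show ?case using \<open>0 < a\<close> by simp
          qed
        next
          fix a :: real assume "a < 0"
          then show "\<forall>\<^sub>F n in sequentially. a < tau (snd \<omega>) p \<one> (b n)"
            by (intro always_eventually allI less_le_trans[OF _ tau_nonneg])
        qed
      qed
    qed (auto intro: tau_meas)
    then have "(\<lambda>n. \<phi> p \<one> (b n)) \<longlonglongrightarrow> 0" by (simp add: \<phi>_def)
    then have "\<forall>\<^sub>F n in sequentially. \<phi> p \<one> (b n) < \<delta>" using \<delta> by (rule order_tendstoD)
    then obtain n where "\<phi> p \<one> (b n) < \<delta>" by (auto simp: eventually_sequentially)
    moreover have "\<phi> p \<one> (b n) > \<delta>" using b(2) by auto
    ultimately show False by simp
  qed
  define e where "e = from_nat_into (carrier G)"
  define ei where "ei = to_nat_on (carrier G)"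
  have e: "e i \<in> carrier G" for i unfolding e_def using inf by (intro from_nat_into) auto
  have ei [simp]: "ei (e i) = i" for i
    unfolding e_def ei_def by (rule to_nat_on_from_nat_into_infinite[OF countable_carrier inf])
  have e_ei [simp]: "e (ei g) = g" if "g \<in> carrier G" for g
    unfolding e_def ei_def by (rule from_nat_into_to_nat_on[OF countable_carrier that])
  \<comment> \<open>Only finitely many pairs are controlled at stage \<open>n\<close>, so one
    parameter close to 1 serves them all; a fixed pair is controlled from some stage on, by a
    geometric series.\<close>
  have "\<exists>p. 0 \<le> p \<and> p < 1 \<and> (\<forall>i\<le>n. \<forall>j\<le>n. 1 - \<phi> p (e i) (e j) < (1/2) ^ n)" for n :: nat
  proof -
    have "\<forall>\<^sub>F k in sequentially. \<phi> (1 - inverse (real (Suc k))) (e i) (e j) > 1 - (1/2) ^ n" for i j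
      by (rule order_tendstoD(1)[OF \<phi>_lim[OF e e]]) simp
    then have "\<forall>\<^sub>F k in sequentially. \<forall>i\<in>{..n}. \<forall>j\<in>{..n}.
        \<phi> (1 - inverse (real (Suc k))) (e i) (e j) > 1 - (1/2) ^ n"
      by (intro eventually_ball_finite finite_atMost ballI)
    then obtain k where "\<forall>i\<in>{..n}. \<forall>j\<in>{..n}.
        \<phi> (1 - inverse (real (Suc k))) (e i) (e j) > 1 - (1/2) ^ n"
      by (auto simp: eventually_sequentially)
    then show ?thesis
      by (intro exI[of _ "1 - inverse (real (Suc k))"])
        (auto simp: inverse_le_1_iff algebra_simps simp del: of_nat_Suc)
  qed
  then obtain q where q: "\<And>n. 0 \<le> q n" "\<And>n. q n < 1"
    and q_small: "\<And>n i j. i \<le> n \<Longrightarrow> j \<le> n \<Longrightarrow> 1 - \<phi> (q n) (e i) (e j) < (1/2) ^ n"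
    by metis
  have summ: "summable (\<lambda>n. 1 - \<phi> (q n) (e i) (e j))" for i j
  proof (rule summable_comparison_test')
    show "summable (\<lambda>n. (1/2 :: real) ^ n)" by simp
    show "norm (1 - \<phi> (q n) (e i) (e j)) \<le> (1/2) ^ n" if "n \<ge> max i j" for n
      using q_small[of i n j] \<phi>_le[of "q n" "e i" "e j"] that by auto
  qed
  define \<psi> where "\<psi> i j = (\<Sum>n. 1 - \<phi> (q n) (e i) (e j))" for i j
  \<comment> \<open>The factor one half and the sign make \<open>quad\<close> of a difference of
    point masses at \<open>i\<close> and \<open>j\<close> equal to \<open>\<psi> i j\<close>, as
    \<psi> vanishes on the diagonal.\<close>
  define P where "P i j = - \<psi> i j / 2" for i j
  define z where "z = ei \<one>"
  define \<beta> where "\<beta> g i = ei (g \<otimes> e i)" for g i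
  have P_refl: "P i i = 0" for i by (simp add: P_def \<psi>_def \<phi>_refl)
  have P_pos: "0 \<le> ev (\<lambda>x. ev (\<lambda>y. P x y) c) c" for c
  proof -
    \<comment> \<open>Constants vanish on test measures, so subtracting 1 from \<phi> keeps the form
      nonnegative; the partial sums then converge entrywise to \<open>P\<close>.\<close>
    let ?PN = "\<lambda>N x y. \<Sum>n<N. (1/2) * (\<phi> (q n) (e x) (e y) - 1)"
    have "0 \<le> ev (\<lambda>x. ev (\<lambda>y. \<phi> p (e x) (e y)) c) c" for p
      unfolding \<phi>_def
    proof (rule ev_ev_integral_nonneg[OF tau_int])
      fix \<omega> assume "\<omega> \<in> space \<mu>"
      then have \<omega>: "\<omega> \<in> space KS" using D(3) by simp
      show "0 \<le> ev (\<lambda>x. ev (\<lambda>y. tau (snd \<omega>) p (e x) (e y)) c) c"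
        by (rule tau_positive[OF countable_carrier snd_sub_carrier[OF \<omega>]])
    qed
    then have pos: "0 \<le> ev (\<lambda>x. ev (\<lambda>y. ?PN N x y) c) c" for N
      unfolding ev_sum ev_mult ev_diff ev_const by (intro sum_nonneg) simp
    have lim: "(\<lambda>N. ev (\<lambda>x. ev (\<lambda>y. ?PN N x y) c) c) \<longlonglongrightarrow> ev (\<lambda>x. ev (\<lambda>y. P x y) c) c"
    proof (intro tendsto_ev)
      fix x y
      have "(\<lambda>n. - (1/2) * (1 - \<phi> (q n) (e x) (e y))) sums (- (1/2) * \<psi> x y)"
        unfolding \<psi>_def by (intro sums_mult summable_sums summ)
      then show "(\<lambda>N. ?PN N x y) \<longlonglongrightarrow> P x y"
        by (simp add: sums_def P_def algebra_simps)
    qed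
    show ?thesis by (rule LIMSEQ_le_const[OF lim]) (use pos in blast)
  qed
  interpret ker: invariant_kernel P z G \<beta>
  proof
    show "P x y = P y x" for x y by (simp add: P_def \<psi>_def \<phi>_sym)
    show "0 \<le> ev (\<lambda>x. ev (\<lambda>y. P x y) c) c" for c by (rule P_pos)
    show "\<beta> (g \<otimes> h) x = \<beta> g (\<beta> h x)" if "g \<in> carrier G" "h \<in> carrier G" for g h x
      using that e by (simp add: \<beta>_def m_assoc)
    show "\<beta> \<one> x = x" for x using e by (simp add: \<beta>_def)
    show "P (\<beta> g x) (\<beta> g y) = P x y" if "g \<in> carrier G" for g x y
      using that e q less_imp_le[OF q(2)] by (simp add: P_def \<psi>_def \<beta>_def \<phi>_inv)
  qed
  have "proper_affine_isometric_action G ker.hspace ker.inner ker.act"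
  proof (rule ker.proper_act)
    fix M :: real
    \<comment> \<open>If \<phi> were at most one half for all \<open>n < N\<close>, the first
      \<open>N\<close> terms of \<psi> would sum to at least \<open>N / 2\<close>, more than
      \<open>M\<close>.\<close>
    obtain N :: nat where N: "real N > 2 * M" using reals_Archimedean2 by blast
    have "{g \<in> carrier G. ker.quad [(1, \<beta> g z, z)] \<le> M}
        \<subseteq> (\<Union>n\<in>{..<N}. {g \<in> carrier G. \<phi> (q n) \<one> g > 1/2})"
    proof clarify
      fix g assume g: "g \<in> carrier G" "ker.quad [(1, \<beta> g z, z)] \<le> M"
      have \<beta>z: "\<beta> g z = ei g" using g by (simp add: \<beta>_def z_def)
      have "ker.quad [(1, ei g, z)] = \<psi> z (ei g)"
        using ker.P_sym[of z "ei g"] by (simp add: ker.form_def P_refl) (simp add: P_def)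
      then have \<psi>: "\<psi> z (ei g) \<le> M" using g(2) unfolding \<beta>z by simp
      show "g \<in> (\<Union>n\<in>{..<N}. {g \<in> carrier G. \<phi> (q n) \<one> g > 1/2})"
      proof (rule ccontr)
        assume "\<not> ?thesis"
        then have "1 - \<phi> (q n) \<one> g \<ge> 1/2" if "n < N" for n using g that by force
        then have "(\<Sum>n<N. 1/2) \<le> (\<Sum>n<N. 1 - \<phi> (q n) (e z) (e (ei g)))"
          using g by (intro sum_mono) (simp add: z_def)
        also have "\<dots> \<le> \<psi> z (ei g)"
          unfolding \<psi>_def using \<phi>_le by (intro sum_le_suminf summ) auto
        finally show False using N \<psi> by simp
      qed
    qed
    then show "finite {g \<in> carrier G. ker.quad [(1, \<beta> g z, z)] \<le> M}"
      by (rule finite_subset) (intro finite_UN_I finite_lessThan \<phi>_c0 q, simp)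
  qed
  then show ?thesis by (auto simp: haagerup_def)
qed

end

theorem theorem3p9:
  fixes G :: "('a, 'b) monoid_scheme" and S :: "'a set"
  assumes "group G"
    and "infinite (carrier G)"
    and "S \<subseteq> carrier G"
    and "finite S"
    and "\<forall>s\<in>S. inv\<^bsub>G\<^esub> s \<in> S"
    and "generate G S = carrier G"
  shows "(random_spanning_pconn_1 G S \<longleftrightarrow> random_nonempty_pconn_1_pos G S) \<and>
         (random_spanning_pconn_1 G S \<or> random_nonempty_pconn_1_pos G S \<longrightarrow> haagerup G)"
proof -
  interpret cayley G S
    using assms by (simp add: cayley_def cayley_axioms_def)
  show ?thesis
    using random_spanning_imp_nonempty random_nonempty_imp_spanning spanning_imp_haagerup[OF assms(2)]
    by blast
qed

end
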